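(* For every real $z\ne0$, \[ \frac{\cosh(\pi z)-1}{3z^2}=\cfrac{5}{3(1-z^2)+\cfrac{(1+4z^2)(1+9z^2)}{25+9z^2+\cfrac{(4+4z^2)(4+9z^2)}{69+9z^2+\cdots}}}, \] i.e. the continued fraction with $a(0)=0$, $a(1)=3(1-z^2)$, $a(n)=11n^2-11n+3+9z^2$ for $n\ge2$, $b(0)=5$, $b(n)=(n^2+4z^2)(n^2+9z^2)$ for $n\ge1$. Moreover, with $p(n)/q(n)$ its $n$-th convergent, as $n\to\infty$ \[ \frac{\cosh(\pi z)-1}{3z^2}-\frac{p(n)}{q(n)}\sim(-1)^n\frac{\frac{2}{3z^2}\sinh(2\pi z)\sinh(3\pi z)}{\big((1+\sqrt5)/2\big)^{10n+5}}. \]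
   Context: For sequences $a(n),b(n)$, the continued fraction is $a(0)+\cfrac{b(0)}{a(1)+\cfrac{b(1)}{a(2)+\cdots}}$ and its $n$-th convergent $p(n)/q(n)$ is the truncation ending with $b(n-1)/a(n)$. *)

theory Defs
  imports "HOL-Analysis.Analysis" "HOL-Library.Landau_Symbols"
begin

text \<open>Numerators and denominators of the convergents of the continued fraction
  a(0) + b(0)/(a(1) + b(1)/(a(2) + ...)), via the standard three-term recurrences.
  The n-th convergent cf_p a b n / cf_q a b n is the truncation ending with b(n-1)/a(n).\<close>

fun cf_p :: "(nat \<Rightarrow> real) \<Rightarrow> (nat \<Rightarrow> real) \<Rightarrow> nat \<Rightarrow> real" where
  "cf_p a b 0 = a 0"
| "cf_p a b (Suc 0) = a 1 * a 0 + b 0"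
| "cf_p a b (Suc (Suc n)) = a (n + 2) * cf_p a b (Suc n) + b (n + 1) * cf_p a b n"

fun cf_q :: "(nat \<Rightarrow> real) \<Rightarrow> (nat \<Rightarrow> real) \<Rightarrow> nat \<Rightarrow> real" where
  "cf_q a b 0 = 1"
| "cf_q a b (Suc 0) = a 1"
| "cf_q a b (Suc (Suc n)) = a (n + 2) * cf_q a b (Suc n) + b (n + 1) * cf_q a b n"

definition cf7_a :: "real \<Rightarrow> nat \<Rightarrow> real" where
  "cf7_a z n = (if n = 0 then 0 else if n = 1 then 3 * (1 - z^2)
               else 11 * real n ^ 2 - 11 * real n + 3 + 9 * z^2)"

definition cf7_b :: "real \<Rightarrow> nat \<Rightarrow> real" where
  "cf7_b z n = (if n = 0 then 5 else (real n ^ 2 + 4 * z^2) * (real n ^ 2 + 9 * z^2))"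

end

theory Submission
  imports Defs "HOL-Probability.Distributions" "HOL-Real_Asymp.Real_Asymp"
begin

text \<open>
  Let $L$ be the claimed value, $y = z^2$, and write $P_y(m) = \prod_{j=1}^m (j^2 + y)$. The error
  $q(n) L - p(n)$ is $(-1)^n \cosh(\pi z)$ times the positive series
  \[ E(n) = \frac{P_{4y}(n) P_{9y}(n)}{n!} \sum_{k \ge 0} \frac{P_y(n+k)\,(n+k)!}{P_{4y}(2n+1+k)\,k!}: \]
  by creative telescoping it satisfies the same three-term recurrence (up to alternating signs), and
  its initial values follow from telescoping sums. The products in the summand differ from factorials by factors
  that converge uniformly in $k$ to values of $\sinh$, so asymptotically only the case $z = 0$ matters.
  There the series is the double integral of $(xy(1-x)(1-y))^n/(1-xy)^{n+1}$ over the unit square, to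
  which Laplace's method applies at $x = y = (\sqrt 5 - 1)/2$. Finally, the Casoratian
  $q(n) E(n+1) + q(n+1) E(n)$ is an explicit product; read as a first-order recurrence for $q$ with a
  contracting coefficient, it yields the asymptotics of $q(n)$ from those of $E(n)$.
\<close>

subsection \<open>A hypergeometric series and its three-term recurrence\<close>

text \<open>At z = 0 this is Apery's continued fraction for zeta(2): the left side tends to pi^2/6,
  and a(n), b(n) become 11n^2 - 11n + 3 and n^4. For every z, dividing q(n) by (n!)^2 leads in the
  limit to x(n+1) = 11 x(n) + x(n-1), with characteristic roots phi^5 and -phi^(-5), phi the golden
  ratio. Such an argument alone yields ratios of consecutive values but not the constant in front,
  so the small solution has to be explicit; E(n) is that solution without its alternating sign.
  Positivity gives no direct control of q(n): a(1) = 3(1 - z^2) makes q(1) zero or negative once |z|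
  >= 1. In the recurrence read off the Casoratian the normalised coefficient tends to phi^(-10), so
  the contribution of the initial values dies out, and q(n) is nonzero from some point on because
  its normalised limit is positive. The outer products P_(4y)(n) and P_(9y)(n) supply sinh(2 pi z)
  and sinh(3 pi z); those inside the summand supply only 1/cosh(pi z), which cancels the factor
  cosh(pi z) of the error.\<close>

definition shifted_prod :: "real \<Rightarrow> nat \<Rightarrow> real" where
  "shifted_prod y m = (\<Prod>j=1..m. real j ^ 2 + y)"

lemma shifted_prod_0 [simp]: "shifted_prod y 0 = 1"
  by (simp add: shifted_prod_def)

lemma shifted_prod_Suc:
  "shifted_prod y (Suc m) = ((real m + 1) ^ 2 + y) * shifted_prod y m"
  by (simp add: shifted_prod_def add.commute)

lemma shifted_prod_pos: "y \<ge> 0 \<Longrightarrow> shifted_prod y m > 0"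
  by (auto simp: shifted_prod_def intro!: prod_pos add_pos_nonneg)

definition series_term :: "real \<Rightarrow> nat \<Rightarrow> nat \<Rightarrow> real" where
  "series_term y n k = shifted_prod y (n + k) * fact (n + k) / (shifted_prod (4 * y) (2 * n + 1 + k) * fact k)"

lemma series_term_pos: "y \<ge> 0 \<Longrightarrow> series_term y n k > 0"
  by (simp add: series_term_def shifted_prod_pos)

lemma series_term_step_n:
  "series_term y (Suc m) k = series_term y m k *
    ((((real m + real k + 1) ^ 2 + y) * (real m + real k + 1)) /
     (((2 * real m + real k + 2) ^ 2 + 4 * y) * ((2 * real m + real k + 3) ^ 2 + 4 * y)))"
proof -
  have 1: "Suc m + k = Suc (m + k)" "2 * Suc m + 1 + k = Suc (Suc (2 * m + 1 + k))" by simp_all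
  have e: "real (m + k) + 1 = real m + real k + 1" "real (2 * m + 1 + k) + 1 = 2 * real m + real k + 2"
    "real (Suc (2 * m + 1 + k)) + 1 = 2 * real m + real k + 3" "real (Suc (m+k)) = real m + real k + 1"
    by simp_all
  show ?thesis
    unfolding series_term_def 1 shifted_prod_Suc fact_Suc e of_nat_mult by (simp add: ac_simps)
qed

lemma series_term_step_k:
  "series_term y m (Suc k) = series_term y m k *
    ((((real m + real k + 1) ^ 2 + y) * (real m + real k + 1)) /
     (((2 * real m + real k + 2) ^ 2 + 4 * y) * (real k + 1)))"
proof -
  have 1: "m + Suc k = Suc (m + k)" "2 * m + 1 + Suc k = Suc (2 * m + 1 + k)" by simp_all
  have e: "real (m + k) + 1 = real m + real k + 1" "real (2 * m + 1 + k) + 1 = 2 * real m + real k + 2"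
    "real (Suc (m+k)) = real m + real k + 1" "real (Suc k) = real k + 1"
    by simp_all
  show ?thesis
    unfolding series_term_def 1 shifted_prod_Suc fact_Suc e of_nat_mult by (simp add: ac_simps)
qed

text \<open>A polynomial certificate found by creative telescoping, i.e. by solving a linear system for
  the coefficients in $k$ and interpolating these in $n$ and $y$.\<close>

definition zeilberger_cert :: "real \<Rightarrow> real \<Rightarrow> real \<Rightarrow> real" where
  "zeilberger_cert n y k =
     (-16*y-80*y^2-64*y^3-83*n*y-279*n*y^2-76*n*y^3-32*n^2-328*n^2*y-442*n^2*y^2-195*n^3
      -717*n^3*y-255*n^3*y^2-472*n^4-714*n^4*y-566*n^5-258*n^5*y-336*n^6-79*n^7)
   + (-19*y-103*y^2-12*y^3-44*n-292*n*y-422*n*y^2-317*n^2-1059*n^2*y-355*n^2*y^2-892*n^3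
      -1394*n^3*y-1226*n^4-608*n^4*y-824*n^5-217*n^6) * k
   + (-16-84*y-124*y^2-157*n-562*n*y-172*n*y^2-560*n^2-1063*n^2*y-935*n^3-597*n^3*y
      -741*n^4-225*n^5) * k^2
   + (-19-100*y-24*y^2-119*n-382*n*y-276*n^2-318*n^2*y-278*n^3-102*n^4) * k^3
   + (-4-59*y-17*n-95*n*y-26*n^2-13*n^3) * k^4
   + (3-12*y+7*n+4*n^2) * k^5 + (1+n) * k^6"

text \<open>The telescoping relation for the summands, divided by \<open>series_term y m k\<close>
  with n = m + 1 and multiplied by the denominators of all ratios. The factor k + 1 of the shifted
  certificate term has cancelled against the k! of the summand.\<close>

lemma zeilberger_cert_identity:
  "((n+1)^2+4*y) * ((n+1)^2+9*y) * (((n+k)^2+y) * ((n+k+1)^2+y) * (n+k) * (n+k+1))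
   + (n+1) * (11*n^2+11*n+3+9*y) * (((n+k)^2+y) * (n+k) * ((2*n+k+2)^2+4*y) * ((2*n+k+3)^2+4*y))
   - n * (n+1) * (((2*n+k)^2+4*y) * ((2*n+k+1)^2+4*y) * ((2*n+k+2)^2+4*y) * ((2*n+k+3)^2+4*y))
   = zeilberger_cert n y (k+1) * ((n+k)^2+y) * (n+k) - k * zeilberger_cert n y k * ((2*n+k+3)^2+4*y)"
  unfolding zeilberger_cert_def by algebra

text \<open>The leading factor k makes it vanish at k = 0, so that the sum over k has no lower
  boundary term.\<close>

definition telescoper :: "real \<Rightarrow> nat \<Rightarrow> nat \<Rightarrow> real" where
  "telescoper y m k = real k * zeilberger_cert (real m + 1) y (real k) * series_term y m k /
     (((2 * real m + real k + 2)^2 + 4 * y) * ((2 * real m + real k + 3)^2 + 4 * y) *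
      ((2 * real m + real k + 4)^2 + 4 * y))"

text \<open>Over the common denominator \<open>D 0 * D 1 * D 2 * D 3\<close> every term is
  \<open>series_term y m k\<close> times a polynomial, and the certificate identity compares these
  polynomials. Here \<open>n\<close> is the middle one of the three indices.\<close>

lemma series_term_telescope:
  fixes m k :: nat and y :: real
  assumes "y \<ge> 0"
  defines "n \<equiv> real m + 1"
  shows "((n + 1)^2 + 4*y) * ((n + 1)^2 + 9*y) * series_term y (Suc (Suc m)) k
     + (n + 1) * (11 * n^2 + 11 * n + 3 + 9 * y) * series_term y (Suc m) k
     - n * (n + 1) * series_term y m k = telescoper y m (Suc k) - telescoper y m k"
proof -
  define K where "K = real k"
  define D where "D i = (2 * n + K + i)^2 + 4 * y" for i
  define N where "N i = (n + K + i)^2 + y" for i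
  define t where "t = series_term y m k"
  have K: "K \<ge> 0" "n \<ge> 1" by (simp_all add: K_def n_def)
  have D0: "D i \<noteq> 0" if "i \<ge> 0" for i
  proof -
    have "(2 * n + K + i)^2 > 0" using that K by (intro zero_less_power) linarith
    then show ?thesis using assms(1) unfolding D_def by linarith
  qed
  have T1: "series_term y (Suc m) k = t * (N 0 * (n + K) / (D 0 * D 1))"
    unfolding series_term_step_n t_def D_def N_def n_def K_def by (simp add: algebra_simps)
  have T2: "series_term y (Suc (Suc m)) k = t * (N 0 * (n + K) / (D 0 * D 1)) * (N 1 * (n + K + 1) / (D 2 * D 3))"
    unfolding series_term_step_n[of y "Suc m"] T1 unfolding t_def D_def N_def n_def K_def by (simp add: algebra_simps)
  have Gk: "telescoper y m k = K * zeilberger_cert n y K * t / (D 0 * D 1 * D 2)"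
    unfolding telescoper_def t_def D_def n_def K_def by (simp add: algebra_simps)
  have GS: "telescoper y m (Suc k) = (K + 1) * zeilberger_cert n y (K + 1) * (t * (N 0 * (n + K) / (D 0 * (K + 1)))) / (D 1 * D 2 * D 3)"
    unfolding telescoper_def series_term_step_k unfolding t_def D_def N_def n_def K_def by (simp add: algebra_simps)
  have GS': "telescoper y m (Suc k) = zeilberger_cert n y (K + 1) * t * N 0 * (n + K) / (D 0 * D 1 * D 2 * D 3)"
    unfolding GS using K D0[of 0] D0[of 1] D0[of 2] D0[of 3] by (simp add: divide_simps)
  have id: "((n+1)^2+4*y) * ((n+1)^2+9*y) * (N 0 * N 1 * (n+K) * (n+K+1))
     + (n+1) * (11*n^2+11*n+3+9*y) * (N 0 * (n+K) * D 2 * D 3)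
     - n * (n+1) * (D 0 * D 1 * D 2 * D 3)
     = zeilberger_cert n y (K+1) * N 0 * (n+K) - K * zeilberger_cert n y K * D 3"
    using zeilberger_cert_identity[of n y K] unfolding N_def D_def by (simp only: add_0_right)
  define A where "A = D 0 * D 1 * D 2 * D 3"
  have A: "A \<noteq> 0" using D0 by (simp add: A_def)
  have e1: "series_term y (Suc m) k = t * (N 0 * (n+K) * D 2 * D 3) / A"
    unfolding T1 A_def using D0 by (simp add: divide_simps)
  have e2: "series_term y (Suc (Suc m)) k = t * (N 0 * N 1 * (n+K) * (n+K+1)) / A"
    unfolding T2 A_def using D0 by (simp add: divide_simps)
  have e3: "series_term y m k = t * (D 0 * D 1 * D 2 * D 3) / A"
    using A unfolding A_def t_def by simp
  have e4: "telescoper y m k = t * (K * zeilberger_cert n y K * D 3) / A"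
    unfolding Gk A_def using D0 by (simp add: divide_simps)
  have e5: "telescoper y m (Suc k) = t * (zeilberger_cert n y (K+1) * N 0 * (n+K)) / A"
    unfolding GS' A_def by (simp add: ac_simps)
  have "((n + 1)^2 + 4*y) * ((n + 1)^2 + 9*y) * series_term y (Suc (Suc m)) k
     + (n + 1) * (11 * n^2 + 11 * n + 3 + 9 * y) * series_term y (Suc m) k
     - n * (n + 1) * series_term y m k =
    t * (((n+1)^2+4*y) * ((n+1)^2+9*y) * (N 0 * N 1 * (n+K) * (n+K+1))
     + (n+1) * (11*n^2+11*n+3+9*y) * (N 0 * (n+K) * D 2 * D 3)
     - n * (n+1) * (D 0 * D 1 * D 2 * D 3)) / A"
  proof -
    have lin: "a * (t * x / A) + b * (t * u / A) - c * (t * v / A) = t * (a * x + b * u - c * v) / A"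
      for a b c x u v by (simp add: add_divide_distrib diff_divide_distrib algebra_simps)
    show ?thesis unfolding e1 e2 lin[symmetric] using e3 by simp
  qed
  also have "\<dots> = telescoper y m (Suc k) - telescoper y m k"
    unfolding id e4 e5 by (simp add: diff_divide_distrib ring_distribs)
  finally show ?thesis .
qed

subsection \<open>Limits of the products\<close>

text \<open>What \<open>shifted_prod\<close> keeps after division by (m!)^2: a partial product of
  Euler's product for sinh, hence convergent.\<close>

definition sprod :: "real \<Rightarrow> nat \<Rightarrow> real" where
  "sprod y m = (\<Prod>j=1..m. 1 + y / real j ^ 2)"

lemma shifted_prod_eq: "shifted_prod y m = fact m ^ 2 * sprod y m"
proof (induction m)
  case (Suc m)
  have "(real m + 1)^2 + y = (real m + 1)^2 * (1 + y / (real m + 1)^2)"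
    by (simp add: field_simps)
  then show ?case
    by (simp add: shifted_prod_Suc Suc sprod_def power_mult_distrib add.commute mult_ac)
qed (simp add: sprod_def)

lemma sprod_ge_1: "y \<ge> 0 \<Longrightarrow> sprod y m \<ge> 1"
  unfolding sprod_def by (rule prod_ge_1) simp

lemma sprod_mono: "y \<ge> 0 \<Longrightarrow> mono (sprod y)"
  by (rule incseq_SucI) (auto simp: sprod_def algebra_simps intro!: divide_nonneg_nonneg mult_nonneg_nonneg prod_nonneg add_nonneg_nonneg)

text \<open>Euler's product for the sine at the imaginary point i x; taking imaginary parts returns
  to the reals.\<close>

lemma sprod_limit:
  assumes "x \<noteq> 0"
  shows "sprod (x^2) \<longlonglongrightarrow> sinh (pi * x) / (pi * x)"
proof -
  have "(\<lambda>n. of_real pi * (\<i> * of_real x) * (\<Prod>k=1..n. 1 - (\<i> * of_real x)^2 / of_nat k^2))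
      \<longlonglongrightarrow> sin (of_real pi * (\<i> * of_real x))"
    by (rule sin_product_formula_complex)
  also have "(\<lambda>n. of_real pi * (\<i> * of_real x) * (\<Prod>k=1..n. 1 - (\<i> * of_real x)^2 / of_nat k^2))
    = (\<lambda>n. \<i> * of_real (pi * x * sprod (x^2) n))"
    by (simp add: sprod_def power_mult_distrib fun_eq_iff)
  also have "sin (of_real pi * (\<i> * of_real x)) = \<i> * (of_real (sinh (pi * x)) :: complex)"
  proof -
    have "sin (of_real pi * (\<i> * of_real x)) = sin (\<i> * (of_real (pi * x) :: complex))"
      by (simp add: mult_ac)
    also have "\<dots> = \<i> * sinh (of_real (pi * x))"
      by (simp add: sinh_conv_sin mult_ac)
    also have "sinh (of_real (pi * x)) = (of_real (sinh (pi * x)) :: complex)"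
      by (simp add: sinh_field_def exp_of_real[symmetric])
    finally show ?thesis .
  qed
  finally have "(\<lambda>n. Im (\<i> * of_real (pi * x * sprod (x^2) n))) \<longlonglongrightarrow> Im (\<i> * (of_real (sinh (pi * x)) :: complex))"
    by (rule tendsto_Im)
  then have "(\<lambda>n. pi * x * sprod (x^2) n) \<longlonglongrightarrow> sinh (pi * x)" by simp
  from tendsto_divide[OF this tendsto_const[of "pi * x"]] show ?thesis using assms by simp
qed

subsection \<open>Recurrence and initial values of the sums\<close>

text \<open>Isolates the dependence on y in a quotient of convergent products, which leaves y = 0 as
  the only case that needs an integral.\<close>

lemma series_term_eq: "series_term y n k = sprod y (n + k) / sprod (4 * y) (2 * n + 1 + k) * series_term 0 n k"
  by (simp add: series_term_def shifted_prod_eq sprod_def[of 0] mult_ac)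

text \<open>Equality holds at n = 0, where the series is that of zeta(2); raising n multiplies the
  term by a ratio at most 1.\<close>

lemma series_term_0_le: "series_term 0 n k \<le> 1 / (real k + 1)^2"
proof (induction n)
  case 0
  show ?case
    by (simp add: series_term_def shifted_prod_eq sprod_def power_mult_distrib add.commute)
next
  case (Suc n)
  have "(real n + real k + 1) ^ 2 * (real n + real k + 1)
      \<le> (2 * real n + real k + 2) ^ 2 * (2 * real n + real k + 3) ^ 2"
  proof (intro mult_mono power_mono)
    have "real n + real k + 1 \<le> 2 * real n + real k + 3" by simp
    also have "\<dots> \<le> (2 * real n + real k + 3) ^ 2" by (rule self_le_power) auto
    finally show "real n + real k + 1 \<le> (2 * real n + real k + 3) ^ 2" .
  qed auto
  then have "(real n + real k + 1) ^ 2 * (real n + real k + 1)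
      / ((2 * real n + real k + 2) ^ 2 * (2 * real n + real k + 3) ^ 2) \<le> 1"
    by (intro divide_le_eq_1_pos[THEN iffD2]) (auto intro!: mult_pos_pos zero_less_power)
  then have "series_term 0 (Suc n) k \<le> series_term 0 n k"
    unfolding series_term_step_n using series_term_pos[of 0 n k] by (intro mult_left_le) auto
  with Suc show ?case by linarith
qed

lemma series_term_le_0:
  assumes "y \<ge> 0"
  shows "series_term y n k \<le> series_term 0 n k"
proof -
  have "sprod y (n + k) \<le> sprod (4 * y) (n + k)"
    unfolding sprod_def using assms by (intro prod_mono) (auto intro!: divide_right_mono)
  also have "\<dots> \<le> sprod (4 * y) (2 * n + 1 + k)"
    using sprod_mono[of "4 * y"] assms by (auto simp: mono_def)
  finally have "sprod y (n + k) / sprod (4 * y) (2 * n + 1 + k) \<le> 1"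
    using sprod_ge_1[of "4 * y" "2 * n + 1 + k"] assms by simp
  then show ?thesis
    unfolding series_term_eq[of y] using series_term_pos[of 0 n k] by (intro mult_left_le_one_le) 
      (use sprod_ge_1[of "4 * y" "2 * n + 1 + k"] sprod_ge_1[of "y" "n + k"] assms in auto)
qed

lemma series_term_le: "y \<ge> 0 \<Longrightarrow> series_term y n k \<le> 1 / (real k + 1)^2"
  using series_term_le_0 series_term_0_le order_trans by blast

lemma summable_series_term: "y \<ge> 0 \<Longrightarrow> summable (series_term y n)"
proof (rule summable_comparison_test'[of "\<lambda>k. 1 / (real k + 1)^2" 0])
  show "summable (\<lambda>k. 1 / (real k + 1)^2)"
    using summable_Suc_iff[of "\<lambda>k. 1 / real k ^ 2"] inverse_power_summable[of 2, where 'a=real]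
    by (simp add: field_simps)
  show "\<And>k. 0 \<le> k \<Longrightarrow> y \<ge> 0 \<Longrightarrow> norm (series_term y n k) \<le> 1 / (real k + 1)^2"
    using series_term_le[of y n] series_term_pos[of y n] by (simp add: less_imp_le)
qed

definition series_sum :: "real \<Rightarrow> nat \<Rightarrow> real" where "series_sum y n = (\<Sum>k. series_term y n k)"

lemma series_sum_pos: "y \<ge> 0 \<Longrightarrow> series_sum y n > 0"
  unfolding series_sum_def by (intro suminf_pos summable_series_term series_term_pos) auto

lemma series_sum_sums: "y \<ge> 0 \<Longrightarrow> series_term y n sums series_sum y n"
  unfolding series_sum_def by (intro summable_sums summable_series_term)

text \<open>The certificate has degree six in k, so the rational factor is of degree seven over six
  and grows linearly, while the summand is at most 1 / (k + 1)^2. \<open>R\<close> is that factor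
  divided by k + 1; its limit m + 2 is the leading coefficient of the certificate.\<close>

lemma telescoper_limit:
  assumes "y \<ge> 0"
  shows "telescoper y m \<longlonglongrightarrow> 0"
proof -
  define R where "R k = real k * zeilberger_cert (real m + 1) y (real k) /
     (((2 * real m + real k + 2)^2 + 4 * y) * ((2 * real m + real k + 3)^2 + 4 * y) *
      ((2 * real m + real k + 4)^2 + 4 * y)) / (real k + 1)" for k
  \<comment> \<open>One monomial at a time, so that the limits are free of the long symbolic
    coefficients; only degree six survives.\<close>
  define W where "W i k = real k * real k ^ i /
     (((2 * real m + real k + 2)^2 + 4 * y) * ((2 * real m + real k + 3)^2 + 4 * y) *
      ((2 * real m + real k + 4)^2 + 4 * y)) / (real k + 1)" for i k
  have "\<exists>c0 c1 c2 c3 c4 c5. \<forall>x. zeilberger_cert (real m + 1) y x =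
      c0 * x^0 + c1 * x^1 + c2 * x^2 + c3 * x^3 + c4 * x^4 + c5 * x^5 + (1 + (real m + 1)) * x^6"
    unfolding zeilberger_cert_def power_0 power_one_right mult_1_right by (intro exI allI) (rule refl)
  then obtain c0 c1 c2 c3 c4 c5 where c: "zeilberger_cert (real m + 1) y x =
      c0 * x^0 + c1 * x^1 + c2 * x^2 + c3 * x^3 + c4 * x^4 + c5 * x^5 + (real m + 2) * x^6" for x
    by (auto simp: add.commute)
  have W: "W 0 \<longlonglongrightarrow> 0" "W 1 \<longlonglongrightarrow> 0" "W 2 \<longlonglongrightarrow> 0" "W 3 \<longlonglongrightarrow> 0"
    "W 4 \<longlonglongrightarrow> 0" "W 5 \<longlonglongrightarrow> 0" "W 6 \<longlonglongrightarrow> 1"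
    unfolding W_def by real_asymp+
  have "R = (\<lambda>k. c0 * W 0 k + c1 * W 1 k + c2 * W 2 k + c3 * W 3 k + c4 * W 4 k + c5 * W 5 k
      + (real m + 2) * W 6 k)"
    unfolding R_def W_def c by (rule ext) (simp only: distrib_left add_divide_distrib, simp add: mult_ac)
  moreover have "(\<lambda>k. c0 * W 0 k + c1 * W 1 k + c2 * W 2 k + c3 * W 3 k + c4 * W 4 k + c5 * W 5 k
      + (real m + 2) * W 6 k) \<longlonglongrightarrow> c0 * 0 + c1 * 0 + c2 * 0 + c3 * 0 + c4 * 0 + c5 * 0 + (real m + 2) * 1"
    by (intro tendsto_add tendsto_mult tendsto_const W)
  ultimately have R: "R \<longlonglongrightarrow> real m + 2" by simp
  have t: "(\<lambda>k. (real k + 1) * series_term y m k) \<longlonglongrightarrow> 0"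
  proof (rule real_tendsto_sandwich[OF _ _ tendsto_const])
    show "\<forall>\<^sub>F k in sequentially. 0 \<le> (real k + 1) * series_term y m k"
      using series_term_pos[OF assms, of m] by (auto intro!: mult_nonneg_nonneg simp: less_imp_le)
    have "(real k + 1) * series_term y m k \<le> 1 / (real k + 1)" for k
    proof -
      have "(real k + 1) * series_term y m k \<le> (real k + 1) * (1 / (real k + 1)^2)"
        by (intro mult_left_mono series_term_le assms) auto
      also have "\<dots> = 1 / (real k + 1)" by (simp add: power2_eq_square)
      finally show ?thesis .
    qed
    then show "\<forall>\<^sub>F k in sequentially. (real k + 1) * series_term y m k \<le> 1 / (real k + 1)" by simp
    show "(\<lambda>k. 1 / (real k + 1)) \<longlonglongrightarrow> 0" by real_asymp
  qed
  have "telescoper y m = (\<lambda>k. R k * ((real k + 1) * series_term y m k))"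
    by (rule ext, simp add: R_def telescoper_def)
  then show ?thesis using tendsto_mult[OF R t] by simp
qed

lemma series_sum_recurrence:
  fixes m :: nat
  assumes "y \<ge> 0"
  defines "n \<equiv> real m + 1"
  shows "((n + 1)^2 + 4*y) * ((n + 1)^2 + 9*y) * series_sum y (Suc (Suc m))
     + (n + 1) * (11 * n^2 + 11 * n + 3 + 9 * y) * series_sum y (Suc m)
     - n * (n + 1) * series_sum y m = 0"
proof -
  have "(\<lambda>k. telescoper y m (Suc k) - telescoper y m k) sums (0 - telescoper y m 0)"
    by (rule telescope_sums[OF telescoper_limit[OF assms(1)]])
  moreover have "(\<lambda>k. telescoper y m (Suc k) - telescoper y m k) sums
     (((n + 1)^2 + 4*y) * ((n + 1)^2 + 9*y) * series_sum y (Suc (Suc m))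
     + (n + 1) * (11 * n^2 + 11 * n + 3 + 9 * y) * series_sum y (Suc m)
     - n * (n + 1) * series_sum y m)"
    unfolding series_term_telescope[OF assms(1), symmetric] n_def
    by (intro sums_add sums_diff sums_mult series_sum_sums assms(1))
  ultimately show ?thesis using sums_unique2 by (fastforce simp: telescoper_def)
qed

text \<open>At n = 0 the factorials cancel, and the summand becomes a difference of the quotients
  P_y(k) / P_(4y)(k). The divisor 3 y is the difference of j^2 + 4 y and j^2 + y.\<close>

lemma series_sum_0:
  assumes "y > 0" and lim: "(\<lambda>k. sprod y k / sprod (4 * y) k) \<longlonglongrightarrow> d"
  shows "series_sum y 0 = (1 - d) / (3 * y)"
proof -
  define U where "U k = - (shifted_prod y k / shifted_prod (4 * y) k) / (3 * y)" for k
  have "U = (\<lambda>k. - (sprod y k / sprod (4 * y) k) / (3 * y))"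
    by (simp add: U_def shifted_prod_eq fun_eq_iff)
  then have "U \<longlonglongrightarrow> - d / (3 * y)"
    using tendsto_divide[OF tendsto_minus[OF lim] tendsto_const[of "3 * y"]] assms(1) by simp
  then have "(\<lambda>k. U (Suc k) - U k) sums (- d / (3 * y) - U 0)"
    by (rule telescope_sums)
  moreover have "U (Suc k) - U k = series_term y 0 k" for k
  proof -
    have "shifted_prod (4 * y) k > 0" "(real k + 1)^2 + 4 * y > 0"
      using assms(1) by (auto intro: shifted_prod_pos add_nonneg_pos)
    then show ?thesis
      using assms(1) by (simp add: U_def series_term_def shifted_prod_Suc divide_simps) (simp add: algebra_simps)
  qed
  ultimately show ?thesis
    using sums_unique2[OF series_sum_sums[of y 0]] assms(1) by (fastforce simp: U_def diff_divide_distrib)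
qed

text \<open>The second initial value: 3 (1 - y) is a(1), and the 5 on the right, which is the
  leading coefficient of \<open>X\<close>, becomes b(0).\<close>

lemma series_sum_1:
  assumes "y > 0" and lim: "(\<lambda>k. sprod y k / sprod (4 * y) k) \<longlonglongrightarrow> d"
  shows "(1 + 4 * y) * (1 + 9 * y) * series_sum y 1 + 3 * (1 - y) * series_sum y 0 = 5 * d"
proof -
  \<comment> \<open>the antidifference \<open>H\<close> comes from Gosper's algorithm\<close>
  define X where "X k = 5 * k^4 + (27 - 12 * y) * k^3 + (48 - 28 * y) * k^2
    + (29 - 7 * y - 12 * y^2) * k" for k :: real
  define H where "H k = X (real k) * shifted_prod y k / shifted_prod (4 * y) (k + 2)" for k
  define R where "R k = X (real k) / (((real k + 1)^2 + 4*y) * ((real k + 2)^2 + 4*y))" for k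
  have R: "R \<longlonglongrightarrow> 5" unfolding R_def X_def by real_asymp
  have H: "H = (\<lambda>k. R k * (sprod y k / sprod (4 * y) k))"
    by (simp add: H_def R_def shifted_prod_eq[symmetric] fun_eq_iff shifted_prod_Suc numeral_2_eq_2)
       (simp add: shifted_prod_eq add.commute add.left_commute)
  have "H \<longlonglongrightarrow> 5 * d"
    unfolding H by (intro tendsto_mult R lim)
  then have "(\<lambda>k. H (Suc k) - H k) sums (5 * d - H 0)"
    by (rule telescope_sums)
  moreover have "(1 + 4 * y) * (1 + 9 * y) * series_term y 1 k + 3 * (1 - y) * series_term y 0 k = H (Suc k) - H k" for k
  proof -
    define K where "K = real k"
    define D where "D i = (K + i)^2 + 4 * y" for i
    define N where "N = (K + 1)^2 + y"
    define A where "A = D 1 * D 2 * D 3"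
    define t where "t = shifted_prod y k / shifted_prod (4 * y) k"
    have D: "D i > 0" for i unfolding D_def using assms(1) by (intro add_nonneg_pos) auto
    have p: "shifted_prod (4 * y) k > 0" using assms(1) by (intro shifted_prod_pos) auto
    have s1: "shifted_prod (4*y) (Suc k) = D 1 * shifted_prod (4*y) k"
      "shifted_prod (4*y) (Suc (Suc k)) = D 2 * (D 1 * shifted_prod (4*y) k)"
      "shifted_prod (4*y) (Suc (Suc (Suc k))) = D 3 * (D 2 * (D 1 * shifted_prod (4*y) k))"
      "shifted_prod y (Suc k) = N * shifted_prod y k"
      by (simp_all add: shifted_prod_Suc D_def N_def K_def add.commute)
    have T1: "series_term y 1 k = t * (N * (K + 1)) / A"
      unfolding series_term_def t_def A_def using D p
      by (simp add: s1 numeral_2_eq_2 numeral_3_eq_3 K_def add.commute divide_simps)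
    have T0: "series_term y 0 k = t * (D 2 * D 3) / A"
      unfolding series_term_def t_def A_def using D[of 1] D[of 2] D[of 3] p by (simp add: s1 divide_simps)
    have H0: "H k = t * (X K * D 3) / A"
      unfolding H_def t_def A_def using D[of 1] D[of 2] D[of 3] p
      by (simp add: s1 numeral_2_eq_2 K_def divide_simps)
    have H1: "H (Suc k) = t * (X (K + 1) * N) / A"
      unfolding H_def t_def A_def using D[of 1] D[of 2] D[of 3] p
      by (simp add: s1 numeral_2_eq_2 K_def divide_simps add.commute)
    have "(1 + 4*y) * (1 + 9*y) * (N * (K + 1)) + 3 * (1 - y) * (D 2 * D 3) = X (K + 1) * N - X K * D 3"
      unfolding N_def D_def X_def by algebra
    moreover have "a * (t * x / A) + b * (t * u / A) = t * (a * x + b * u) / A" for a b x u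
      by (simp add: add_divide_distrib algebra_simps)
    ultimately show ?thesis unfolding T1 T0 H0 H1
      by (simp add: diff_divide_distrib right_diff_distrib)
  qed
  \<comment> \<open>\<open>X\<close> has no constant term, so \<open>H 0 = 0\<close> and only the
    limit at infinity contributes.\<close>
  ultimately have "(\<lambda>k. (1 + 4 * y) * (1 + 9 * y) * series_term y 1 k + 3 * (1 - y) * series_term y 0 k) sums (5 * d)"
    by (simp add: H_def X_def)
  moreover have "(\<lambda>k. (1 + 4 * y) * (1 + 9 * y) * series_term y 1 k + 3 * (1 - y) * series_term y 0 k) sums
      ((1 + 4 * y) * (1 + 9 * y) * series_sum y 1 + 3 * (1 - y) * series_sum y 0)"
    using assms(1) by (intro sums_add sums_mult series_sum_sums) auto
  ultimately show ?thesis using sums_unique2 by blast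
qed

text \<open>Both products increase to their limits, so the quotient in \<open>series_term_eq\<close>
  lies between \<open>sprod y n / s2\<close> and \<open>s1 / sprod (4 * y) (2 * n + 1)\<close>.
  These bounds do not involve k and therefore pass to the sums.\<close>

lemma series_sum_ratio_limit:
  assumes "y \<ge> 0" "sprod y \<longlonglongrightarrow> s1" "sprod (4 * y) \<longlonglongrightarrow> s2"
  shows "(\<lambda>n. series_sum y n / series_sum 0 n) \<longlonglongrightarrow> s1 / s2"
proof -
  have ge1: "sprod y i \<ge> 1" "sprod (4 * y) i \<ge> 1" for i
    using assms(1) by (auto intro: sprod_ge_1)
  have mono: "mono (sprod y)" "mono (sprod (4 * y))"
    using assms(1) by (auto intro: sprod_mono)
  have le: "sprod y i \<le> s1" "sprod (4 * y) i \<le> s2" for i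
    using incseq_le mono assms by blast+
  have s: "s1 \<ge> 1" "s2 \<ge> 1" using ge1[of 0] le[of 0] by linarith+
  have lower: "sprod y n / s2 \<le> series_sum y n / series_sum 0 n" for n
  proof -
    have "sprod y n / s2 * series_term 0 n k \<le> series_term y n k" for k
      unfolding series_term_eq[of y] using series_term_pos[of 0 n k] ge1 s le(2)[of "2 * n + 1 + k"] mono(1)
      by (intro mult_right_mono frac_le) (auto simp: mono_def intro: less_le_trans[OF zero_less_one] order_trans[OF zero_le_one])
    then have "sprod y n / s2 * series_sum 0 n \<le> series_sum y n"
      using assms(1) by (intro sums_le[OF _ sums_mult[OF series_sum_sums] series_sum_sums]) auto
    then show ?thesis using series_sum_pos[of 0 n] by (simp add: pos_le_divide_eq)
  qed
  have upper: "series_sum y n / series_sum 0 n \<le> s1 / sprod (4 * y) (2 * n + 1)" for n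
  proof -
    have "series_term y n k \<le> s1 / sprod (4 * y) (2 * n + 1) * series_term 0 n k" for k
      unfolding series_term_eq[of y] using series_term_pos[of 0 n k] ge1 s le(1)[of "n + k"] mono(2)
      by (intro mult_right_mono frac_le) (auto simp: mono_def intro: less_le_trans[OF zero_less_one] order_trans[OF zero_le_one])
    then have "series_sum y n \<le> s1 / sprod (4 * y) (2 * n + 1) * series_sum 0 n"
      using assms(1) by (intro sums_le[OF _ series_sum_sums sums_mult[OF series_sum_sums]]) auto
    then show ?thesis using series_sum_pos[of 0 n] by (simp add: pos_divide_le_eq)
  qed
  show ?thesis
  proof (rule real_tendsto_sandwich)
    show "(\<lambda>n. sprod y n / s2) \<longlonglongrightarrow> s1 / s2"
      using s by (intro tendsto_intros assms) auto
    have "filterlim (\<lambda>n::nat. 2 * n + 1) at_top sequentially" by real_asymp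
    then show "(\<lambda>n. s1 / sprod (4 * y) (2 * n + 1)) \<longlonglongrightarrow> s1 / s2"
      using s by (intro tendsto_intros filterlim_compose[OF assms(3)]) auto
  qed (use lower upper in auto)
qed

subsection \<open>The double integral\<close>

text \<open>Newton's binomial series with exponent -(n + 1), rewritten with factorials.\<close>

lemma negative_binomial_sums:
  fixes u :: real
  assumes "\<bar>u\<bar> < 1"
  shows "(\<lambda>k. fact (n + k) / (fact n * fact k) * u ^ k) sums (1 / (1 - u) ^ Suc n)"
proof -
  have "(\<lambda>k. ((- (real n + 1)) gchoose k) * (- u) ^ k) sums (1 + (- u)) powr (- (real n + 1))"
    using assms by (intro gen_binomial_real) auto
  moreover have "((- (real n + 1)) gchoose k) * (- u) ^ k = fact (n + k) / (fact n * fact k) * u ^ k" for k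
  proof -
    have "((- (real n + 1)) gchoose k) = (-1) ^ k * (real (n + k) gchoose k)"
      by (subst gbinomial_minus) (simp add: algebra_simps)
    also have "(real (n + k) gchoose k) = fact (n + k) / (fact n * fact k)"
      by (subst binomial_gbinomial[symmetric], subst binomial_fact) (simp_all add: mult.commute)
    finally show ?thesis
      by (simp add: power_minus[of u])
  qed
  moreover have "(1 + (- u)) powr (- (real n + 1)) = 1 / (1 - u) ^ Suc n"
  proof -
    have "(1 - u) powr (- real (Suc n)) = 1 / (1 - u) ^ Suc n"
      using assms by (subst powr_minus_divide, subst powr_realpow) auto
    then show ?thesis by (simp add: algebra_simps)
  qed
  ultimately show ?thesis by simp
qed

lemma nn_integral_beta:
  "(\<integral>\<^sup>+x. ennreal (x ^ a * (1 - x) ^ b) * indicator {0<..<1} x \<partial>lborel)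
     = ennreal (fact a * fact b / fact (a + b + 1))"
proof -
  have "((\<lambda>t. t powr (real (Suc a) - 1) * (1 - t) powr (real (Suc b) - 1))
      has_integral Beta (real (Suc a)) (real (Suc b))) {0..1}"
    by (rule has_integral_Beta_real) auto
  also have "Beta (real (Suc a)) (real (Suc b)) = fact a * fact b / fact (a + b + 1)"
    using Gamma_fact[of a, where 'a = real] Gamma_fact[of b, where 'a = real]
      Gamma_fact[of "a + b + 1", where 'a = real]
    by (simp add: Beta_def algebra_simps)
  finally have "((\<lambda>t. t powr (real (Suc a) - 1) * (1 - t) powr (real (Suc b) - 1))
      has_integral (fact a * fact b / fact (a + b + 1))) {0<..<1}"
    by (simp add: has_integral_Icc_iff_Ioo)
  then have "((\<lambda>t. t ^ a * (1 - t) ^ b) has_integral (fact a * fact b / fact (a + b + 1) :: real)) {0<..<1}"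
    by (rule has_integral_eq[rotated]) (auto simp: powr_realpow)
  then show ?thesis
    by (intro nn_integral_has_integral_lebesgue') auto
qed

text \<open>At $y = 0$ the series is Apery's: expanding \<open>(1 - x y)^(-n-1)\<close> and integrating termwise turns
  it into Beukers' double integral.\<close>

definition beukers_kernel :: "nat \<Rightarrow> real \<times> real \<Rightarrow> real" where
  "beukers_kernel n p = (case p of (x, y) \<Rightarrow>
     (x * y * (1 - x) * (1 - y)) ^ n / (1 - x * y) ^ Suc n)"

lemma beukers_kernel_measurable [measurable]: "beukers_kernel n \<in> borel_measurable borel"
proof -
  have "(\<lambda>p::real\<times>real. (fst p * snd p * (1 - fst p) * (1 - snd p)) ^ n / (1 - fst p * snd p) ^ Suc n) \<in> borel_measurable borel"
    unfolding borel_prod[symmetric] by measurable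
  then show ?thesis by (simp add: beukers_kernel_def[abs_def] case_prod_beta')
qed

abbreviation unit_square :: "(real \<times> real) set" where
  "unit_square \<equiv> {0<..<1} \<times> {0<..<1}"

text \<open>Everything is nonnegative, so sum and integrals may be exchanged freely. The k-th
  binomial coefficient times the square of a Beta integral is n! times the summand, hence the factor
  n!.\<close>

lemma nn_integral_beukers_kernel:
  "(\<integral>\<^sup>+p. ennreal (beukers_kernel n p) * indicator unit_square p \<partial>lborel) = ennreal (fact n * series_sum 0 n)"
proof -
  define g where "g k x = ennreal (x ^ (n + k) * (1 - x) ^ n) * indicator {0<..<1} x" for k and x :: real
  define c where "c k = (fact (n + k) / (fact n * fact k) :: real)" for k
  have [measurable]: "g k \<in> borel_measurable borel" for k
    unfolding g_def by measurable
  have g_int: "(\<integral>\<^sup>+x. g k x \<partial>lborel) = ennreal (fact (n + k) * fact n / fact (2 * n + 1 + k))" for k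
  proof -
    have "n + k + n + 1 = 2 * n + 1 + k" by simp
    then show ?thesis unfolding g_def nn_integral_beta by (simp only:)
  qed
  have mult3: "ennreal (a * (b * d)) = ennreal a * (ennreal b * ennreal d)"
    if "a \<ge> 0" "b \<ge> 0" "d \<ge> 0" for a b d
    using that by (simp add: ennreal_mult)
  have expand: "ennreal (beukers_kernel n p) * indicator unit_square p = (\<Sum>k. ennreal (c k) * (g k (fst p) * g k (snd p)))" for p
  proof (cases "p \<in> unit_square")
    case True
    obtain x y where p: "p = (x, y)" by force
    have xy: "0 < x" "x < 1" "0 < y" "y < 1" using True p by auto
    have "x * y < 1" using xy mult_strict_mono[of x 1 y 1] by simp
    then have "\<bar>x * y\<bar> < 1" using xy by simp
    from sums_mult[OF negative_binomial_sums[OF this], of "(x * y * (1 - x) * (1 - y)) ^ n" n]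
    moreover have "(x * y * (1 - x) * (1 - y)) ^ n * (fact (n + k) / (fact n * fact k) * (x * y) ^ k)
        = c k * (x ^ (n + k) * (1 - x) ^ n * (y ^ (n + k) * (1 - y) ^ n))" for k
      by (simp only: c_def power_add power_mult_distrib mult_ac)
    ultimately have "(\<lambda>k. c k * (x ^ (n + k) * (1 - x) ^ n * (y ^ (n + k) * (1 - y) ^ n))) sums beukers_kernel n p"
      by (simp add: beukers_kernel_def p)
    then have "(\<Sum>k. ennreal (c k * (x ^ (n + k) * (1 - x) ^ n * (y ^ (n + k) * (1 - y) ^ n)))) = ennreal (beukers_kernel n p)"
      using xy by (intro suminf_ennreal_eq) (auto simp: c_def)
    moreover have "ennreal (c k * (x ^ (n + k) * (1 - x) ^ n * (y ^ (n + k) * (1 - y) ^ n)))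
       = ennreal (c k) * (g k (fst p) * g k (snd p))" for k
    proof -
      have "g k (fst p) = ennreal (x ^ (n + k) * (1 - x) ^ n)" "g k (snd p) = ennreal (y ^ (n + k) * (1 - y) ^ n)"
        using xy by (simp_all add: g_def p)
      moreover have "0 \<le> c k" "0 \<le> x ^ (n + k) * (1 - x) ^ n" "0 \<le> y ^ (n + k) * (1 - y) ^ n"
        using xy by (simp_all add: c_def)
      ultimately show ?thesis using mult3 by presburger
    qed
    ultimately show ?thesis using True by simp
  next
    case False
    then have z: "ennreal (c k) * (g k (fst p) * g k (snd p)) = 0" for k
      by (cases p) (auto simp: g_def indicator_def)
    show ?thesis unfolding z using False by simp
  qed
  have pair: "(\<integral>\<^sup>+p. g k (fst p) * g k (snd p) \<partial>lborel) = (\<integral>\<^sup>+x. g k x \<partial>lborel) * (\<integral>\<^sup>+x. g k x \<partial>lborel)" for k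
  proof -
    have "(\<integral>\<^sup>+p. g k (fst p) * g k (snd p) \<partial>lborel) = (\<integral>\<^sup>+p. g k (fst p) * g k (snd p) \<partial>(lborel \<Otimes>\<^sub>M lborel))"
      by (simp add: lborel_prod)
    also have "\<dots> = (\<integral>\<^sup>+x. \<integral>\<^sup>+y. g k x * g k y \<partial>lborel \<partial>lborel)"
      by (subst lborel.nn_integral_fst[symmetric]) auto
    finally show ?thesis by (simp add: nn_integral_cmult nn_integral_multc)
  qed
  have meas: "(\<lambda>p. ennreal (c k) * (g k (fst p) * g k (snd p))) \<in> borel_measurable lborel" for k
    unfolding lborel_prod[symmetric] by measurable
  have "(\<integral>\<^sup>+p. ennreal (beukers_kernel n p) * indicator unit_square p \<partial>lborel)
     = (\<Sum>k. \<integral>\<^sup>+p. ennreal (c k) * (g k (fst p) * g k (snd p)) \<partial>lborel)"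
    unfolding expand by (rule nn_integral_suminf[OF meas])
  also have "\<dots> = (\<Sum>k. ennreal (fact n * series_term 0 n k))"
  proof (rule suminf_cong)
    fix k
    have m: "(\<lambda>p. g k (fst p) * g k (snd p)) \<in> borel_measurable lborel"
      unfolding lborel_prod[symmetric] by measurable
    have "(\<integral>\<^sup>+p. ennreal (c k) * (g k (fst p) * g k (snd p)) \<partial>lborel)
       = ennreal (c k * (fact (n + k) * fact n / fact (2 * n + 1 + k) * (fact (n + k) * fact n / fact (2 * n + 1 + k))))"
      unfolding nn_integral_cmult[OF m] pair g_int by (rule mult3[symmetric]) (simp_all add: c_def)
    also have "c k * (fact (n + k) * fact n / fact (2 * n + 1 + k) * (fact (n + k) * fact n / fact (2 * n + 1 + k)))
       = fact n * series_term 0 n k"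
    proof -
      have "F / (N * K) * (F * N / M * (F * N / M)) = N * (F^2 * F / (M^2 * K))"
        if "N \<noteq> 0" "K \<noteq> 0" "M \<noteq> 0" for F N K M :: real
        using that by (simp add: power2_eq_square mult_ac)
      then show ?thesis
        unfolding c_def series_term_def shifted_prod_eq by (simp add: sprod_def del: fact_Suc)
    qed
    finally show "(\<integral>\<^sup>+p. ennreal (c k) * (g k (fst p) * g k (snd p)) \<partial>lborel) = ennreal (fact n * series_term 0 n k)" .
  qed
  also have "\<dots> = ennreal (fact n * series_sum 0 n)"
    by (intro suminf_ennreal_eq sums_mult series_sum_sums) (auto simp: series_term_pos less_imp_le)
  finally show ?thesis .
qed

section \<open>Gaussian integrals in one and two variables\<close>

lemma nn_integral_gaussian:
  fixes a \<mu> :: real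
  assumes "a > 0"
  shows "(\<integral>\<^sup>+x. ennreal (exp (- (a * (x - \<mu>)^2))) \<partial>lborel) = ennreal (sqrt (pi / a))"
proof -
  define \<sigma> where "\<sigma> = 1 / sqrt (2 * a)"
  have \<sigma>: "\<sigma> > 0" "\<sigma>^2 = 1 / (2 * a)" using assms by (simp_all add: \<sigma>_def power_divide)
  have e: "exp (- (a * (x - \<mu>)^2)) = sqrt (pi / a) * normal_density \<mu> \<sigma> x" for x
  proof -
    have s: "2 * pi * \<sigma>^2 = pi / a" "- ((x - \<mu>)^2) / (2 * \<sigma>^2) = - (a * (x - \<mu>)^2)"
      unfolding \<sigma>(2) using assms by (simp_all add: field_simps)
    show ?thesis unfolding normal_density_def s using assms by simp
  qed
  have "(\<integral>\<^sup>+x. ennreal (exp (- (a * (x - \<mu>)^2))) \<partial>lborel)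
      = (\<integral>\<^sup>+x. ennreal (sqrt (pi / a) * normal_density \<mu> \<sigma> x) \<partial>lborel)"
    unfolding e ..
  also have "\<dots> = ennreal (\<integral>x. sqrt (pi / a) * normal_density \<mu> \<sigma> x \<partial>lborel)"
    using \<sigma> assms by (intro nn_integral_eq_integral) auto
  also have "(\<integral>x. sqrt (pi / a) * normal_density \<mu> \<sigma> x \<partial>lborel) = sqrt (pi / a)"
    using \<sigma> by simp
  finally show ?thesis .
qed

text \<open>Completing the square in the second variable replaces a rotation of the plane and leaves
  one Gaussian in each variable. The root in the result comes from
  \<open>C * E = 4 * A * B\<close>.\<close>

lemma nn_integral_gaussian_pair:
  fixes A B :: real
  assumes "A > 0" "B > 0"
  shows "(\<integral>\<^sup>+p. ennreal (exp (- (A * (fst p + snd p)^2 + B * (fst p - snd p)^2))) \<partial>lborel)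
     = ennreal (pi / (2 * sqrt (A * B)))"
proof -
  define C where "C = A + B"
  define E where "E = 4 * A * B / C"
  have C: "C > 0" "E > 0" using assms by (simp_all add: C_def E_def)
  have sq: "A * (x + y)^2 + B * (x - y)^2 = C * (y - (- (A - B) / C * x))^2 + E * (x - 0)^2" for x y
  proof -
    have "C * (C * (y - (- (A - B) / C * x))^2) = (C * y + (A - B) * x)^2"
      using C by (simp add: power2_eq_square field_simps)
    moreover have "C * (E * x^2) = 4 * A * B * x^2" using C by (simp add: E_def)
    moreover have "C * (A * (x + y)^2 + B * (x - y)^2) = (C * y + (A - B) * x)^2 + 4 * A * B * x^2"
      unfolding C_def by algebra
    ultimately have "C * (A * (x + y)^2 + B * (x - y)^2)
        = C * (C * (y - (- (A - B) / C * x))^2 + E * (x - 0)^2)"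
      by (simp only: distrib_left diff_zero)
    then show ?thesis using C by simp
  qed
  have "(\<integral>\<^sup>+p. ennreal (exp (- (A * (fst p + snd p)^2 + B * (fst p - snd p)^2))) \<partial>lborel)
      = (\<integral>\<^sup>+p. ennreal (exp (- (A * (fst p + snd p)^2 + B * (fst p - snd p)^2))) \<partial>(lborel \<Otimes>\<^sub>M lborel))"
    by (simp add: lborel_prod)
  also have "\<dots> = (\<integral>\<^sup>+x. \<integral>\<^sup>+y. ennreal (exp (- (A * (x + y)^2 + B * (x - y)^2))) \<partial>lborel \<partial>lborel)"
    by (subst lborel.nn_integral_fst[symmetric]) auto
  also have "\<dots> = (\<integral>\<^sup>+x. ennreal (exp (- (E * (x - 0)^2))) * (\<integral>\<^sup>+y. ennreal (exp (- (C * (y - (- (A - B) / C * x))^2))) \<partial>lborel) \<partial>lborel)"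
    unfolding sq by (subst nn_integral_cmult[symmetric]) (auto simp: ennreal_mult'[symmetric] mult_exp_exp add.commute)
  also have "\<dots> = ennreal (sqrt (pi / E)) * ennreal (sqrt (pi / C))"
    unfolding nn_integral_gaussian[OF C(1)] by (subst nn_integral_multc) (use nn_integral_gaussian[OF C(2), of 0] in auto)
  also have "\<dots> = ennreal (sqrt (pi / E) * sqrt (pi / C))"
    using C by (simp add: ennreal_mult)
  also have "sqrt (pi / E) * sqrt (pi / C) = sqrt (pi^2 / (2^2 * (A * B)))"
    using C by (simp add: E_def real_sqrt_mult[symmetric] power2_eq_square)
  also have "\<dots> = pi / (2 * sqrt (A * B))"
    by (simp only: real_sqrt_divide real_sqrt_mult) simp
  finally show ?thesis .
qed

subsection \<open>The maximum of the integrand\<close>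

text \<open>The numerator varies with m because the local expansion of the integrand has corrections
  of order 1 / sqrt m. The logarithm differs from \<open>x m / m\<close> by at most twice its
  square, and m times that still tends to 0.\<close>

lemma tendsto_power_exp:
  fixes x :: "nat \<Rightarrow> real"
  assumes "x \<longlonglongrightarrow> L"
  shows "(\<lambda>m. (1 + x m / real m) ^ m) \<longlonglongrightarrow> exp L"
proof -
  have z: "(\<lambda>m. x m / real m) \<longlonglongrightarrow> 0"
    using assms by (rule real_tendsto_divide_at_top) (rule filterlim_real_sequentially)
  have small: "\<forall>\<^sub>F m in sequentially. \<bar>x m / real m\<bar> < 1 / 2"
    using tendstoD[OF z, of "1/2"] by simp
  have "(\<lambda>m. real m * ln (1 + x m / real m) - x m) \<longlonglongrightarrow> 0"
  proof (rule Lim_null_comparison)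
    show "\<forall>\<^sub>F m in sequentially. norm (real m * ln (1 + x m / real m) - x m) \<le> 2 * x m * (x m / real m)"
      using small eventually_gt_at_top[of 0]
    proof eventually_elim
      case (elim m)
      have "\<bar>ln (1 + x m / real m) - x m / real m\<bar> \<le> 2 * (x m / real m)^2"
        using elim by (intro abs_ln_one_plus_x_minus_x_bound) auto
      then have "real m * \<bar>ln (1 + x m / real m) - x m / real m\<bar> \<le> real m * (2 * (x m / real m)^2)"
        by (intro mult_left_mono) auto
      also have "real m * \<bar>ln (1 + x m / real m) - x m / real m\<bar> = \<bar>real m * (ln (1 + x m / real m) - x m / real m)\<bar>"
        by (simp add: abs_mult)
      also have "real m * (ln (1 + x m / real m) - x m / real m) = real m * ln (1 + x m / real m) - x m"
        using elim by (simp add: right_diff_distrib)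
      finally show ?case using elim by (simp add: power2_eq_square)
    qed
    show "(\<lambda>m. 2 * x m * (x m / real m)) \<longlonglongrightarrow> 0"
      using tendsto_mult[OF tendsto_mult[OF tendsto_const[of 2] assms] z] by simp
  qed
  from tendsto_add[OF this assms] have "(\<lambda>m. exp (real m * ln (1 + x m / real m))) \<longlonglongrightarrow> exp L"
    by (intro tendsto_exp) simp
  moreover have "\<forall>\<^sub>F m in sequentially. exp (real m * ln (1 + x m / real m)) = (1 + x m / real m) ^ m"
    using small
  proof eventually_elim
    case (elim m)
    then have "1 + x m / real m > 0" by linarith
    then show ?case by (simp only: exp_of_nat_mult exp_ln)
  qed
  ultimately show ?thesis by (rule Lim_transform_eventually)
qed

definition inv_golden :: real where "inv_golden = (sqrt 5 - 1) / 2"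

lemma inv_golden_sq: "inv_golden^2 = 1 - inv_golden"
  by (simp add: inv_golden_def power2_eq_square field_simps)

lemma inv_golden_bounds: "1/2 < inv_golden" "inv_golden < 1"
proof -
  have "sqrt 5 > sqrt (2^2)" "sqrt 5 < sqrt (3^2)" by (simp_all only: real_sqrt_less_iff) auto
  then show "1/2 < inv_golden" "inv_golden < 1" by (simp_all add: inv_golden_def)
qed

text \<open>Reduction modulo \<open>inv_golden_sq\<close> leaves linear polynomials with Fibonacci
  coefficients, a normal form in which polynomial identities at this point become decidable by
  \<open>algebra\<close>.\<close>

lemma inv_golden_powers: "inv_golden^3 = 2 * inv_golden - 1" "inv_golden^4 = 2 - 3 * inv_golden" "inv_golden^5 = 5 * inv_golden - 3" "inv_golden^6 = 5 - 8 * inv_golden"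
proof -
  have "inv_golden^3 = inv_golden * inv_golden^2" by (simp add: power3_eq_cube power2_eq_square)
  then show 3: "inv_golden^3 = 2 * inv_golden - 1" using inv_golden_sq unfolding inv_golden_sq power2_eq_square by (simp add: algebra_simps)
  have "inv_golden^4 = inv_golden * inv_golden^3" by (simp add: power4_eq_xxxx power3_eq_cube)
  then show 4: "inv_golden^4 = 2 - 3 * inv_golden" using inv_golden_sq unfolding 3 power2_eq_square by (simp add: algebra_simps)
  have "inv_golden^5 = inv_golden * inv_golden^4" by (simp flip: power_Suc)
  then show 5: "inv_golden^5 = 5 * inv_golden - 3" using inv_golden_sq unfolding 4 power2_eq_square by (simp add: algebra_simps)
  have "inv_golden^6 = inv_golden * inv_golden^5" by (simp flip: power_Suc)
  then show "inv_golden^6 = 5 - 8 * inv_golden" using inv_golden_sq unfolding 5 power2_eq_square by (simp add: algebra_simps)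
qed

text \<open>With $x = p^2$, $y = q^2$ this exhibits the maximum of $xy(1-x)(1-y)/(1-xy)$ over the unit
  square as \<open>inv_golden ^ 5\<close>, attained only at \<open>x = y = inv_golden\<close>.\<close>

lemma max_identity:
  fixes p q :: real
  defines "v \<equiv> p * q"
  shows "inv_golden^5 * (1 - v^2) - v^2 * ((1 - p^2) * (1 - q^2))
     = (1 - v) * ((v - inv_golden)^2 * (v + inv_golden^3)) + v^2 * (p - q)^2"
  unfolding v_def inv_golden_powers using inv_golden_sq by algebra

text \<open>Sharpens the maximum to a quadratic gap, which after rescaling becomes a Gaussian
  majorant. Of the constant 32, a factor 16 comes from the estimate \<open>main\<close> and a factor
  2 from 1 + v < 2.\<close>

lemma max_bound_sqrt:
  fixes p q :: real
  assumes "0 < p" "p < 1" "0 < q" "q < 1"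
  shows "(p * q)^2 * ((1 - p^2) * (1 - q^2))
     \<le> inv_golden^5 * (1 - (p * q)^2) * (1 - ((p^2 - inv_golden)^2 + (q^2 - inv_golden)^2) / 32)"
proof -
  define v where "v = p * q"
  define d where "d = (p^2 - inv_golden)^2 + (q^2 - inv_golden)^2"
  have v: "0 < v" "v < 1"
    using assms mult_strict_mono[of p 1 q 1] by (auto simp: v_def)
  note inv_golden = inv_golden_bounds
  have alp: "0 < inv_golden^n" for n using inv_golden by simp
  have d: "0 \<le> d" by (simp add: d_def)
  have main: "inv_golden^5 * d / 16 \<le> (v - inv_golden)^2 * (v + inv_golden^3) + v^2 * (p - q)^2"
  \<comment> \<open>Write g for \<open>inv_golden\<close>. Above the threshold, v^2 >= g^2 / 4 >=
    g^3 / 4, so both squares on the right have coefficients at least g^3 / 4. Below it, v is at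
    distance more than g / 2 from g, and the crude bound d <= 2 suffices.\<close>
  proof (cases "v \<ge> inv_golden / 2")
    case True
    define a b where "a = v - inv_golden" and "b = p - q"
    have "p^2 - inv_golden = a + p * b" "q^2 - inv_golden = a - q * b"
      by (simp_all add: a_def b_def v_def power2_eq_square algebra_simps)
    moreover have "(a + r * b)^2 \<le> 2 * a^2 + 2 * b^2" if "\<bar>r\<bar> \<le> 1" for r
    proof -
      have "r^2 \<le> 1" using that by (simp add: abs_square_le_1)
      then have "(r * b)^2 \<le> b^2" by (simp add: power_mult_distrib mult_left_le_one_le)
      moreover have "0 \<le> (a - r * b)^2" by simp
      ultimately show ?thesis by (simp add: power2_eq_square algebra_simps)
    qed
    from this[of p] this[of "-q"] have "(a + p * b)^2 \<le> 2 * a^2 + 2 * b^2" "(a - q * b)^2 \<le> 2 * a^2 + 2 * b^2"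
      using assms by auto
    ultimately have d4: "d \<le> 4 * (a^2 + b^2)" by (simp add: d_def)
    have "inv_golden^5 * d / 16 \<le> inv_golden^3 / 4 * (a^2 + b^2)"
    proof -
      have "inv_golden^5 * d \<le> inv_golden^3 * (4 * (a^2 + b^2))"
        using inv_golden d4 d by (intro mult_mono power_decreasing) auto
      then show ?thesis by (simp add: algebra_simps)
    qed
    also have "\<dots> \<le> a^2 * (v + inv_golden^3) + v^2 * b^2"
    proof -
      have "inv_golden^3 / 4 \<le> (inv_golden / 2)^2" using inv_golden power_decreasing[of 2 3 inv_golden] by (simp add: power_divide)
      also have "\<dots> \<le> v^2" using True inv_golden by (intro power_mono) auto
      finally have "inv_golden^3 / 4 * b^2 \<le> v^2 * b^2" by (intro mult_right_mono) auto
      moreover have "inv_golden^3 / 4 * a^2 \<le> (v + inv_golden^3) * a^2"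
        using alp[of 3] v by (intro mult_right_mono) auto
      ultimately show ?thesis by (simp add: algebra_simps)
    qed
    finally show ?thesis by (simp add: a_def b_def)
  next
    case False
    have "\<bar>p^2 - inv_golden\<bar> \<le> 1" "\<bar>q^2 - inv_golden\<bar> \<le> 1"
      using assms inv_golden power_le_one[of p 2] power_le_one[of q 2] by (auto simp: abs_le_iff intro: order_trans[of _ 1])
         (smt (verit) zero_le_power2)+
    then have "(p^2 - inv_golden)^2 \<le> 1" "(q^2 - inv_golden)^2 \<le> 1" by (auto simp: abs_square_le_1)
    then have "d \<le> 2" by (simp add: d_def)
    then have "inv_golden^5 * d / 16 \<le> inv_golden^5 / 4" using alp[of 5] by (simp add: field_simps)
    also have "\<dots> = (inv_golden / 2)^2 * inv_golden^3" by (simp add: power_divide flip: power_add)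
    also have "\<dots> \<le> (inv_golden - v)^2 * (v + inv_golden^3)"
      using False v inv_golden alp[of 3] by (intro mult_mono power_mono) auto
    also have "\<dots> \<le> (v - inv_golden)^2 * (v + inv_golden^3) + v^2 * (p - q)^2" by (simp add: power2_commute)
    finally show ?thesis .
  qed
  have "inv_golden^5 * (1 - v^2) * (d / 32) = (1 - v) * (1 + v) * (inv_golden^5 * d / 32)"
    by (simp add: power2_eq_square algebra_simps)
  also have "\<dots> \<le> (1 - v) * 2 * (inv_golden^5 * d / 32)"
    using v d alp[of 5] by (intro mult_right_mono mult_left_mono) auto
  also have "\<dots> = (1 - v) * (inv_golden^5 * d / 16)" by simp
  also have "\<dots> \<le> (1 - v) * ((v - inv_golden)^2 * (v + inv_golden^3) + v^2 * (p - q)^2)"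
    using v by (intro mult_left_mono main) auto
  also have "\<dots> \<le> (1 - v) * ((v - inv_golden)^2 * (v + inv_golden^3)) + v^2 * (p - q)^2"
  proof -
    have "(1 - v) * (v^2 * (p - q)^2) \<le> v^2 * (p - q)^2"
      using v by (intro mult_left_le_one_le) auto
    then show ?thesis by (simp add: distrib_left)
  qed
  also have "\<dots> = inv_golden^5 * (1 - v^2) - v^2 * ((1 - p^2) * (1 - q^2))"
    unfolding v_def max_identity ..
  finally show ?thesis unfolding v_def[symmetric] d_def[symmetric] by (simp add: right_diff_distrib)
qed

lemma max_bound:
  fixes x y :: real
  assumes "0 < x" "x < 1" "0 < y" "y < 1"
  shows "x * y * (1 - x) * (1 - y) / (1 - x * y) \<le> inv_golden^5 * (1 - ((x - inv_golden)^2 + (y - inv_golden)^2) / 32)"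
proof -
  have xy: "x * y < 1" using assms mult_strict_mono[of x 1 y 1] by simp
  have "x * y * ((1 - x) * (1 - y)) \<le> inv_golden^5 * (1 - x * y) * (1 - ((x - inv_golden)^2 + (y - inv_golden)^2) / 32)"
    using max_bound_sqrt[of "sqrt x" "sqrt y"] assms by (simp add: power_mult_distrib)
  then show ?thesis using xy by (simp add: divide_le_eq mult_ac)
qed

subsection \<open>Laplace's method\<close>

lemma nn_integral_affine_pair:
  fixes g :: "real \<times> real \<Rightarrow> ennreal"
  assumes [measurable]: "g \<in> borel_measurable borel" and "c > 0"
  shows "(\<integral>\<^sup>+p. g p \<partial>lborel) = ennreal (c^2) * (\<integral>\<^sup>+p. g (t + c *\<^sub>R p) \<partial>lborel)"
proof -
  have "(\<integral>\<^sup>+p. g p \<partial>lborel)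
     = (\<integral>\<^sup>+p. g p \<partial>density (distr lborel borel (\<lambda>x. t + c *\<^sub>R x)) (\<lambda>_. \<bar>c\<bar>^DIM(real \<times> real)))"
    using arg_cong[OF lborel_affine[of c t], of "\<lambda>M. integral\<^sup>N M g"] assms by simp
  also have "\<dots> = ennreal (c^2) * (\<integral>\<^sup>+p. g (t + c *\<^sub>R p) \<partial>lborel)"
    using assms by (simp add: nn_integral_density nn_integral_distr nn_integral_cmult ennreal_power power2_eq_square)
  finally show ?thesis .
qed

text \<open>Splitting off one factor keeps the weight bounded although $1/(1-xy)$ is singular at $(1,1)$.\<close>

lemma beukers_kernel_Suc:
  "beukers_kernel (Suc m) (x, y) = (x * y * (1 - x) * (1 - y) / (1 - x * y)) ^ m
     * (x * y * (1 - x) * (1 - y) / (1 - x * y)^2)"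
  by (simp add: beukers_kernel_def power_divide power2_eq_square mult_ac)

text \<open>The inequality 1 - d <= exp (- d) turns the quadratic gap into a Gaussian. The weight is
  at most 1 since 1 - x y dominates both 1 - x and 1 - y on the right scale: their product is at
  most (1 - x y)^2.\<close>

lemma beukers_kernel_Suc_bound:
  assumes "(x, y) \<in> unit_square"
  shows "0 \<le> beukers_kernel (Suc m) (x, y)"
    "beukers_kernel (Suc m) (x, y) \<le> inv_golden ^ (5 * m) * exp (- (real m * ((x - inv_golden)^2 + (y - inv_golden)^2) / 32))"
proof -
  define f where "f = x * y * (1 - x) * (1 - y) / (1 - x * y)"
  define w where "w = x * y * (1 - x) * (1 - y) / (1 - x * y)^2"
  define d where "d = ((x - inv_golden)^2 + (y - inv_golden)^2) / 32"
  have xy: "0 < x" "x < 1" "0 < y" "y < 1" using assms by auto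
  then have 1: "x * y < 1" using mult_strict_mono[of x 1 y 1] by simp
  have f0: "0 \<le> f" and w0: "0 \<le> w" using xy 1 by (auto simp: f_def w_def)
  have "f \<le> inv_golden^5 * (1 - d)"
    using max_bound[OF xy] by (simp add: f_def d_def)
  also have "\<dots> \<le> inv_golden^5 * exp (- d)"
    using exp_ge_add_one_self[of "-d"] inv_golden_bounds by (intro mult_left_mono) auto
  finally have "f ^ m \<le> (inv_golden^5 * exp (- d)) ^ m" using f0 by (intro power_mono)
  also have "\<dots> = inv_golden ^ (5 * m) * exp (- (real m * d))"
    by (simp add: power_mult_distrib power_mult exp_of_nat_mult[symmetric])
  finally have fm: "f ^ m \<le> inv_golden ^ (5 * m) * exp (- (real m * d))" .
  have "x * y * (1 - x) * (1 - y) \<le> (1 - x * y)^2"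
  proof -
    have "x * y \<le> y" "x * y \<le> x" using xy by (auto simp: mult_left_le_one_le mult_left_le)
    then have "(1 - x) * (1 - y) \<le> (1 - x * y) * (1 - x * y)"
      using xy 1 by (intro mult_mono) auto
    moreover have "x * y * ((1 - x) * (1 - y)) \<le> (1 - x) * (1 - y)"
      using xy 1 by (intro mult_left_le_one_le) (auto intro: less_imp_le)
    ultimately show ?thesis by (simp add: power2_eq_square mult.assoc)
  qed
  then have w1: "w \<le> 1" using 1 by (simp add: w_def)
  have k: "beukers_kernel (Suc m) (x, y) = f ^ m * w" by (simp only: beukers_kernel_Suc f_def w_def)
  show "0 \<le> beukers_kernel (Suc m) (x, y)" using f0 w0 by (simp add: k)
  have "f ^ m * w \<le> f ^ m" using f0 w0 w1 by (intro mult_left_le) auto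
  with fm show "beukers_kernel (Suc m) (x, y) \<le> inv_golden ^ (5 * m) * exp (- (real m * ((x - inv_golden)^2 + (y - inv_golden)^2) / 32))"
    by (simp add: k d_def)
qed

text \<open>Coefficients of the quadratic part of minus the logarithm of xy(1-x)(1-y)/(1-xy) at its
  maximum. The coordinates s + t and s - t diagonalise it because the function is symmetric in x and
  y.\<close>

definition quad_sum :: real where "quad_sum = inv_golden^2 * (1 + inv_golden^2) / (4 * inv_golden^5)"
definition quad_diff :: real where "quad_diff = 1 / (4 * inv_golden^5)"

text \<open>An exact expansion in place of a Taylor estimate; division by 1 - x y gives the gap to
  the maximum. No linear term in h survives, since the point is critical.\<close>

lemma local_expansion:
  fixes h s t :: real
  defines "x \<equiv> inv_golden + h * s" and "y \<equiv> inv_golden + h * t"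
  shows "inv_golden^5 * (1 - x * y) - x * y * (1 - x) * (1 - y)
    = h^2 * (inv_golden^3 * (s + t)^2 - inv_golden * (s * t) - h * (inv_golden - inv_golden^2) * (s + t) * (s * t) - h^2 * (s * t)^2)"
  unfolding x_def y_def inv_golden_powers using inv_golden_sq by algebra

text \<open>With g for \<open>inv_golden\<close>, the divisor g^6 is g^5 times 1 - g^2 = g, the
  value of 1 - x y at the maximum.\<close>

lemma local_quadratic:
  "(inv_golden^3 * (s + t)^2 - inv_golden * (s * t)) / inv_golden^6 = quad_sum * (s + t)^2 + quad_diff * (s - t)^2"
proof -
  have inv_golden: "inv_golden \<noteq> 0" using inv_golden_bounds by simp
  have "4 * (inv_golden^3 * (s + t)^2 - inv_golden * (s * t)) = inv_golden * (inv_golden^2 * (1 + inv_golden^2) * (s + t)^2 + (s - t)^2)"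
    unfolding inv_golden_powers using inv_golden_sq by algebra
  then have e: "inv_golden^3 * (s + t)^2 - inv_golden * (s * t) = inv_golden * (inv_golden^2 * (1 + inv_golden^2) * (s + t)^2 + (s - t)^2) / 4"
    by simp
  have "inv_golden^6 = inv_golden * inv_golden^5" by (simp flip: power_Suc)
  then show ?thesis
    unfolding e quad_sum_def quad_diff_def using inv_golden by (simp add: add_divide_distrib)
qed

text \<open>At scale 1 / sqrt m the base of the power is g^5 (1 + r m / m) with convergent
  \<open>r\<close> and g for \<open>inv_golden\<close>, so its m-th power over g^(5m) has an
  exponential limit; the remaining weight tends to its value g^4 at the maximum.\<close>

lemma beukers_kernel_pointwise_limit:
  fixes s t :: real
  defines "h \<equiv> \<lambda>m. 1 / sqrt (real m)"
  shows "(\<lambda>m. beukers_kernel (Suc m) (inv_golden + h m * s, inv_golden + h m * t) / inv_golden ^ (5 * m))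
    \<longlonglongrightarrow> inv_golden^4 * exp (- (quad_sum * (s + t)^2 + quad_diff * (s - t)^2))"
proof -
  define x y where "x m = inv_golden + h m * s" and "y m = inv_golden + h m * t" for m
  define P where "P m = inv_golden^3 * (s + t)^2 - inv_golden * (s * t) - h m * (inv_golden - inv_golden^2) * (s + t) * (s * t)
    - (h m)^2 * (s * t)^2" for m
  define r where "r m = - (P m / (inv_golden^5 * (1 - x m * y m)))" for m
  define w where "w m = x m * y m * (1 - x m) * (1 - y m) / (1 - x m * y m)^2" for m
  have inv_golden_pos: "0 < inv_golden" using inv_golden_bounds by simp
  have inv_golden: "inv_golden \<noteq> 0" "1 - inv_golden * inv_golden = inv_golden" using inv_golden_bounds inv_golden_sq by (auto simp: power2_eq_square)
  have h: "h \<longlonglongrightarrow> 0" unfolding h_def by real_asymp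
  have x: "x \<longlonglongrightarrow> inv_golden" "y \<longlonglongrightarrow> inv_golden"
    unfolding x_def y_def by (auto intro!: tendsto_eq_intros h)
  have D: "(\<lambda>m. 1 - x m * y m) \<longlonglongrightarrow> inv_golden"
    using inv_golden by (auto intro!: tendsto_eq_intros x)
  have "P \<longlonglongrightarrow> inv_golden^3 * (s + t)^2 - inv_golden * (s * t)"
    unfolding P_def by (auto intro!: tendsto_eq_intros h)
  then have "r \<longlonglongrightarrow> - ((inv_golden^3 * (s + t)^2 - inv_golden * (s * t)) / (inv_golden^5 * inv_golden))"
    unfolding r_def using inv_golden by (intro tendsto_minus tendsto_divide tendsto_mult tendsto_const D) auto
  also have "inv_golden^5 * inv_golden = inv_golden^6" by (simp flip: power_Suc2)
  finally have "(\<lambda>m. (1 + r m / real m) ^ m) \<longlonglongrightarrow> exp (- (quad_sum * (s + t)^2 + quad_diff * (s - t)^2))"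
    unfolding local_quadratic by (rule tendsto_power_exp)
  moreover have "w \<longlonglongrightarrow> inv_golden * inv_golden * (1 - inv_golden) * (1 - inv_golden) / inv_golden^2"
    unfolding w_def using inv_golden by (intro tendsto_intros x D) auto
  moreover have "inv_golden * inv_golden * (1 - inv_golden) * (1 - inv_golden) / inv_golden^2 = inv_golden^4"
    unfolding inv_golden_sq[symmetric] using inv_golden(1) by (simp add: field_simps power_numeral_reduce)
  ultimately have "(\<lambda>m. w m * (1 + r m / real m) ^ m)
      \<longlonglongrightarrow> inv_golden^4 * exp (- (quad_sum * (s + t)^2 + quad_diff * (s - t)^2))"
    by (intro tendsto_mult) auto
  moreover have "\<forall>\<^sub>F m in sequentially. w m * (1 + r m / real m) ^ m = beukers_kernel (Suc m) (x m, y m) / inv_golden ^ (5 * m)"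
    using order_tendstoD(1)[OF D inv_golden_pos] eventually_gt_at_top[of 0]
  proof eventually_elim
    case (elim m)
    then have D0: "1 - x m * y m \<noteq> 0" by simp
    have "h m ^ 2 = 1 / real m" by (simp add: h_def power_divide)
    then have "inv_golden^5 * (1 - x m * y m) - x m * y m * (1 - x m) * (1 - y m) = P m / real m"
      unfolding x_def y_def local_expansion P_def by simp
    then have e: "x m * y m * (1 - x m) * (1 - y m) = inv_golden^5 * (1 - x m * y m) - P m / real m" by simp
    have "x m * y m * (1 - x m) * (1 - y m) / (1 - x m * y m) = inv_golden^5 * (1 + r m / real m)"
      unfolding e r_def using D0 inv_golden elim by (simp add: divide_simps)
    then show ?case
      unfolding beukers_kernel_Suc w_def using inv_golden by (simp add: power_mult_distrib power_mult)
  qed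
  ultimately have "(\<lambda>m. beukers_kernel (Suc m) (x m, y m) / inv_golden ^ (5 * m))
     \<longlonglongrightarrow> inv_golden^4 * exp (- (quad_sum * (s + t)^2 + quad_diff * (s - t)^2))"
    by (rule Lim_transform_eventually)
  then show ?thesis by (simp only: x_def y_def)
qed

lemma series_sum_0_asymptotics:
  "(\<lambda>n. real n * fact n * series_sum 0 n / inv_golden ^ (5 * n)) \<longlonglongrightarrow> 2 * pi * inv_golden^3 / sqrt (1 + inv_golden^2)"
proof -
  have inv_golden: "0 < inv_golden" using inv_golden_bounds by simp
  define h where "h m = 1 / sqrt (real m)" for m
  define U where "U m p = (ennreal (beukers_kernel (Suc m) p) * indicator unit_square p) * ennreal (1 / inv_golden ^ (5 * m))" for m p
  define V where "V m p = U m ((inv_golden, inv_golden) + h m *\<^sub>R p)" for m p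
  define Vl where "Vl p = ennreal (inv_golden^4 * exp (- (quad_sum * (fst p + snd p)^2 + quad_diff * (fst p - snd p)^2)))" for p :: "real \<times> real"
  \<comment> \<open>The majorant with constant 1/32, rewritten by s^2 + t^2 = ((s + t)^2 + (s -
    t)^2) / 2.\<close>
  define W where "W p = ennreal (exp (- (1/64 * (fst p + snd p)^2 + 1/64 * (fst p - snd p)^2)))" for p :: "real \<times> real"
  have quad: "quad_sum > 0" "quad_diff > 0" using inv_golden by (auto simp: quad_sum_def quad_diff_def add_pos_nonneg)
  have Um [measurable]: "U m \<in> borel_measurable borel" for m
    unfolding U_def by (intro borel_measurable_times_ennreal borel_measurable_const measurable_compose[OF beukers_kernel_measurable] measurable_ennreal borel_measurable_indicator) (simp add: borel_Times)
  have Vm: "V m \<in> borel_measurable lborel" for m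
    unfolding V_def by measurable
  have gm: "(\<lambda>p. ennreal (c * exp (- (a * (fst p + snd p)^2 + b * (fst p - snd p)^2)))) \<in> borel_measurable lborel" for a b c :: real
    unfolding lborel_prod[symmetric] by measurable
  have Vlm: "Vl \<in> borel_measurable lborel" unfolding Vl_def by (rule gm)
  have Wm: "W \<in> borel_measurable lborel" unfolding W_def using gm[of 1 "1/64" "1/64"] by simp
  have lim: "(\<lambda>m. V (Suc m) p) \<longlonglongrightarrow> Vl p" for p
  proof -
    obtain s t where p: "p = (s, t)" by force
    have "h \<longlonglongrightarrow> 0" unfolding h_def by real_asymp
    then have "(\<lambda>m. inv_golden + h m * s) \<longlonglongrightarrow> inv_golden" "(\<lambda>m. inv_golden + h m * t) \<longlonglongrightarrow> inv_golden"
      by (auto intro!: tendsto_eq_intros)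
    then have "\<forall>\<^sub>F m in sequentially. inv_golden + h m * s \<in> {0<..<1} \<and> inv_golden + h m * t \<in> {0<..<1}"
      using inv_golden_bounds by (intro eventually_conj topological_tendstoD) auto
    then have "\<forall>\<^sub>F m in sequentially. ennreal (beukers_kernel (Suc m) (inv_golden + h m * s, inv_golden + h m * t) / inv_golden ^ (5 * m)) = V m p"
    proof eventually_elim
      case (elim m)
      then have "(inv_golden + h m * s, inv_golden + h m * t) \<in> unit_square" by simp
      from beukers_kernel_Suc_bound(1)[OF this, of m] this show ?case
        using inv_golden by (simp add: V_def U_def p ennreal_mult[symmetric])
    qed
    then have "(\<lambda>m. V m p) \<longlonglongrightarrow> Vl p"
      using tendsto_ennrealI[OF beukers_kernel_pointwise_limit[of s t]]
      unfolding Vl_def p h_def fst_conv snd_conv by (rule Lim_transform_eventually[rotated])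
    then show ?thesis by (rule LIMSEQ_Suc)
  qed
  \<comment> \<open>Index 0 is skipped: \<open>h 0 = 0\<close> because 1 / 0 = 0, so
    \<open>V 0\<close> is a positive constant and has no integrable majorant.\<close>
  have bound: "V (Suc m) p \<le> W p" for m p
  proof (cases "(inv_golden, inv_golden) + h (Suc m) *\<^sub>R p \<in> unit_square")
    case True
    obtain s t where p: "p = (s, t)" by force
    have h2: "real (Suc m) * (h (Suc m))^2 = 1" by (simp add: h_def power_divide)
    from True have sq: "(inv_golden + h (Suc m) * s, inv_golden + h (Suc m) * t) \<in> unit_square" by (simp add: p)
    have "real (Suc m) * ((inv_golden + h (Suc m) * s - inv_golden)^2 + (inv_golden + h (Suc m) * t - inv_golden)^2) / 32
      = (real (Suc m) * (h (Suc m))^2) * (s^2 + t^2) / 32"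
      by (simp add: power_mult_distrib algebra_simps)
    also have "\<dots> = 1/64 * (s + t)^2 + 1/64 * (s - t)^2"
      unfolding h2 by (simp add: power2_eq_square field_simps)
    finally have e: "real (Suc m) * ((inv_golden + h (Suc m) * s - inv_golden)^2 + (inv_golden + h (Suc m) * t - inv_golden)^2) / 32
      = 1/64 * (s + t)^2 + 1/64 * (s - t)^2" .
    have "beukers_kernel (Suc (Suc m)) (inv_golden + h (Suc m) * s, inv_golden + h (Suc m) * t) * (1 / inv_golden ^ (5 * Suc m))
      \<le> exp (- (1/64 * (s + t)^2 + 1/64 * (s - t)^2))"
      using beukers_kernel_Suc_bound(2)[OF sq, of "Suc m", unfolded e] inv_golden by (simp add: divide_le_eq mult.commute)
    then show ?thesis
      using sq beukers_kernel_Suc_bound(1)[OF sq, of "Suc m"] inv_golden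
      by (simp add: V_def U_def W_def p ennreal_mult[symmetric] ennreal_leI del: power_Suc)
  next
    case False
    then show ?thesis by (simp add: V_def U_def)
  qed
  have "(\<lambda>m. \<integral>\<^sup>+p. V (Suc m) p \<partial>lborel) \<longlonglongrightarrow> (\<integral>\<^sup>+p. Vl p \<partial>lborel)"
  proof (rule nn_integral_dominated_convergence[where w = W])
    show "(\<integral>\<^sup>+p. W p \<partial>lborel) < \<infinity>"
      unfolding W_def by (subst nn_integral_gaussian_pair) auto
  qed (use Vm Vlm Wm bound lim in auto)
  also have "(\<integral>\<^sup>+p. Vl p \<partial>lborel) = ennreal (inv_golden^4 * (pi / (2 * sqrt (quad_sum * quad_diff))))"
  proof -
    have "(\<integral>\<^sup>+p. Vl p \<partial>lborel) = ennreal (inv_golden^4) * ennreal (pi / (2 * sqrt (quad_sum * quad_diff)))"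
      unfolding nn_integral_gaussian_pair[OF quad, symmetric] Vl_def
      using inv_golden gm[of 1] by (subst nn_integral_cmult[symmetric]) (auto simp: ennreal_mult)
    also have "\<dots> = ennreal (inv_golden^4 * (pi / (2 * sqrt (quad_sum * quad_diff))))"
      using inv_golden quad by (intro ennreal_mult[symmetric]) auto
    finally show ?thesis .
  qed
  also have "(\<lambda>m. \<integral>\<^sup>+p. V (Suc m) p \<partial>lborel)
     = (\<lambda>m. ennreal (real (Suc m) * (fact (Suc (Suc m)) * series_sum 0 (Suc (Suc m))) / inv_golden ^ (5 * Suc m)))"
  proof
    fix m
    have hp: "h (Suc m) > 0" "(h (Suc m))^2 = 1 / real (Suc m)" by (simp_all add: h_def power_divide)
    have "ennreal (fact (Suc (Suc m)) * series_sum 0 (Suc (Suc m)) / inv_golden ^ (5 * Suc m)) = (\<integral>\<^sup>+p. U (Suc m) p \<partial>lborel)"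
      unfolding U_def using inv_golden series_sum_pos[of 0 "Suc (Suc m)"]
      by (subst nn_integral_multc)
         (auto simp: nn_integral_beukers_kernel ennreal_mult[symmetric] borel_Times simp del: fact_Suc
           intro!: borel_measurable_times_ennreal measurable_compose[OF beukers_kernel_measurable] borel_measurable_indicator)
    also have "\<dots> = ennreal (1 / real (Suc m)) * (\<integral>\<^sup>+p. V (Suc m) p \<partial>lborel)"
      unfolding V_def hp(2)[symmetric] by (rule nn_integral_affine_pair[OF Um hp(1)])
    finally have "ennreal (real (Suc m)) * ennreal (fact (Suc (Suc m)) * series_sum 0 (Suc (Suc m)) / inv_golden ^ (5 * Suc m))
       = ennreal (real (Suc m)) * ennreal (1 / real (Suc m)) * (\<integral>\<^sup>+p. V (Suc m) p \<partial>lborel)"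
      by (simp only: mult.assoc)
    also have "ennreal (real (Suc m)) * ennreal (1 / real (Suc m)) = 1"
      by (subst ennreal_mult[symmetric]) auto
    finally show "(\<integral>\<^sup>+p. V (Suc m) p \<partial>lborel)
       = ennreal (real (Suc m) * (fact (Suc (Suc m)) * series_sum 0 (Suc (Suc m))) / inv_golden ^ (5 * Suc m))"
      using inv_golden series_sum_pos[of 0 "Suc (Suc m)"]
      by (subst (asm) ennreal_mult[symmetric]) (auto simp del: fact_Suc of_nat_Suc power_Suc mult_Suc_right)
  qed
  finally have "(\<lambda>m. real (Suc m) * (fact (Suc (Suc m)) * series_sum 0 (Suc (Suc m))) / inv_golden ^ (5 * Suc m))
      \<longlonglongrightarrow> inv_golden^4 * (pi / (2 * sqrt (quad_sum * quad_diff)))"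
    using inv_golden quad series_sum_pos[of 0] by (subst (asm) tendsto_ennreal_iff) (auto simp: less_imp_le simp del: fact_Suc of_nat_Suc power_Suc mult_Suc_right)
  \<comment> \<open>With n = m + 2, the integral carries the factor n - 1 and the power
    \<open>5 * (n - 1)\<close>; multiplying by this sequence restores n and
    \<open>5 * n\<close>.\<close>
  moreover have "(\<lambda>m. real (Suc (Suc m)) / real (Suc m) / inv_golden^5) \<longlonglongrightarrow> 1 / inv_golden^5"
    by (intro tendsto_divide tendsto_const) (use inv_golden in \<open>auto, real_asymp\<close>)
  ultimately have "(\<lambda>m. real (Suc (Suc m)) / real (Suc m) / inv_golden^5 * (real (Suc m) * (fact (Suc (Suc m)) * series_sum 0 (Suc (Suc m))) / inv_golden ^ (5 * Suc m)))
      \<longlonglongrightarrow> 1 / inv_golden^5 * (inv_golden^4 * (pi / (2 * sqrt (quad_sum * quad_diff))))"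
    by (rule tendsto_mult[rotated])
  also have "(\<lambda>m. real (Suc (Suc m)) / real (Suc m) / inv_golden^5 * (real (Suc m) * (fact (Suc (Suc m)) * series_sum 0 (Suc (Suc m))) / inv_golden ^ (5 * Suc m)))
      = (\<lambda>m. real (Suc (Suc m)) * fact (Suc (Suc m)) * series_sum 0 (Suc (Suc m)) / inv_golden ^ (5 * Suc (Suc m)))"
  proof
    fix m
    have "inv_golden ^ (5 * Suc (Suc m)) = inv_golden^5 * inv_golden ^ (5 * Suc m)" by (simp flip: power_add)
    then show "real (Suc (Suc m)) / real (Suc m) / inv_golden^5 * (real (Suc m) * (fact (Suc (Suc m)) * series_sum 0 (Suc (Suc m))) / inv_golden ^ (5 * Suc m))
      = real (Suc (Suc m)) * fact (Suc (Suc m)) * series_sum 0 (Suc (Suc m)) / inv_golden ^ (5 * Suc (Suc m))"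
      by (simp del: fact_Suc of_nat_Suc power_Suc mult_Suc_right)
  qed
  also have "1 / inv_golden^5 * (inv_golden^4 * (pi / (2 * sqrt (quad_sum * quad_diff)))) = 2 * pi * inv_golden^3 / sqrt (1 + inv_golden^2)"
  proof -
    have "quad_sum * quad_diff = (inv_golden * sqrt (1 + inv_golden^2) / (4 * inv_golden^5))^2"
      by (simp add: quad_sum_def quad_diff_def power_mult_distrib power_divide power2_eq_square)
    then have "sqrt (quad_sum * quad_diff) = inv_golden * sqrt (1 + inv_golden^2) / (4 * inv_golden^5)"
      using inv_golden by (simp add: real_sqrt_abs abs_of_nonneg)
    moreover have "sqrt (1 + inv_golden^2) > 0" by (simp add: add_pos_nonneg)
    moreover have "1 / a^5 * (a^4 * (pi / (2 * (a * r / (4 * a^5))))) = 2 * pi * a^3 / r"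
      if "a \<noteq> 0" "r \<noteq> 0" for a r :: real
      using that by (simp add: field_simps power_numeral_reduce)
    ultimately show ?thesis using inv_golden by simp
  qed
  finally show ?thesis
    by (rule LIMSEQ_imp_Suc[OF LIMSEQ_imp_Suc,
          where f = "\<lambda>n. real n * fact n * series_sum 0 n / inv_golden ^ (5 * n)"])
qed

subsection \<open>The continued fraction\<close>

text \<open>Once e is below (1 - r) times \<epsilon>/2, the value \<epsilon>/2 bounds the
  accumulated forcing, and the starting error decays like r^k.\<close>

lemma contraction_tendsto_0:
  fixes d e :: "nat \<Rightarrow> real"
  assumes "r < 1" "e \<longlonglongrightarrow> 0"
    and step: "\<forall>\<^sub>F n in sequentially. \<bar>d (Suc n)\<bar> \<le> r * \<bar>d n\<bar> + e n"
    and "r \<ge> 0"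
  shows "d \<longlonglongrightarrow> 0"
proof (rule tendstoI)
  fix \<epsilon> :: real assume \<epsilon>: "\<epsilon> > 0"
  have "\<forall>\<^sub>F n in sequentially. \<bar>d (Suc n)\<bar> \<le> r * \<bar>d n\<bar> + e n \<and> e n < \<epsilon> / 2 * (1 - r)"
    using \<epsilon> assms(1) by (intro eventually_conj step order_tendstoD(2)[OF assms(2)]) auto
  then have "\<forall>\<^sub>F n in sequentially. \<bar>d (Suc n)\<bar> \<le> r * \<bar>d n\<bar> + \<epsilon> / 2 * (1 - r)"
    by eventually_elim linarith
  then obtain N where N: "\<And>n. n \<ge> N \<Longrightarrow> \<bar>d (Suc n)\<bar> \<le> r * \<bar>d n\<bar> + \<epsilon> / 2 * (1 - r)"
    unfolding eventually_sequentially by blast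
  have b: "\<bar>d (k + N)\<bar> \<le> r ^ k * \<bar>d N\<bar> + \<epsilon> / 2" for k
  proof (induction k)
    case (Suc k)
    have "\<bar>d (Suc k + N)\<bar> \<le> r * \<bar>d (k + N)\<bar> + \<epsilon> / 2 * (1 - r)" using N[of "k + N"] by simp
    also have "\<dots> \<le> r * (r ^ k * \<bar>d N\<bar> + \<epsilon> / 2) + \<epsilon> / 2 * (1 - r)"
      using Suc \<open>r \<ge> 0\<close> by (intro add_right_mono mult_left_mono) auto
    finally show ?case by (simp add: field_simps)
  qed (use \<epsilon> in auto)
  have "(\<lambda>k. r ^ k * \<bar>d N\<bar>) \<longlonglongrightarrow> 0 * \<bar>d N\<bar>"
    using assms by (intro tendsto_mult LIMSEQ_realpow_zero tendsto_const) auto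
  then have "\<forall>\<^sub>F k in sequentially. r ^ k * \<bar>d N\<bar> < \<epsilon> / 2"
    using \<epsilon> by (intro order_tendstoD(2)) auto
  then have "\<forall>\<^sub>F k in sequentially. dist (d (k + N)) 0 < \<epsilon>"
  proof eventually_elim
    case (elim k)
    then show ?case using b[of k] by (simp add: dist_real_def)
  qed
  then show "\<forall>\<^sub>F n in sequentially. dist (d n) 0 < \<epsilon>"
    by (subst (asm) eventually_sequentially_seg)
qed

text \<open>The limit is the fixed point of U = b - r U. Deviations from it contract by (1 + r) / 2,
  a number strictly between r and 1, up to a forcing that tends to 0.\<close>

lemma linear_recurrence_limit:
  fixes u \<beta> \<rho> :: "nat \<Rightarrow> real"
  assumes rec: "\<forall>\<^sub>F n in sequentially. u (Suc n) = \<beta> n - \<rho> n * u n"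
    and \<beta>: "\<beta> \<longlonglongrightarrow> b" and \<rho>: "\<rho> \<longlonglongrightarrow> r" and r: "0 \<le> r" "r < 1"
  shows "u \<longlonglongrightarrow> b / (1 + r)"
proof -
  define U where "U = b / (1 + r)"
  have U: "b = U + r * U" 
  proof -
    have "U * (1 + r) = b" using r by (simp add: U_def)
    then show ?thesis by (simp add: algebra_simps)
  qed
  define e where "e n = \<bar>(\<beta> n - b) - (\<rho> n - r) * U\<bar>" for n
  have "(\<lambda>n. (\<beta> n - b) - (\<rho> n - r) * U) \<longlonglongrightarrow> (b - b) - (r - r) * U"
    by (intro tendsto_intros \<beta> \<rho>)
  then have e0: "e \<longlonglongrightarrow> 0" unfolding e_def by (intro tendsto_rabs_zero) simp
  have "\<forall>\<^sub>F n in sequentially. \<bar>\<rho> n\<bar> < (1 + r) / 2"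
    using order_tendstoD(2)[OF tendsto_rabs[OF \<rho>], of "(1 + r) / 2"] r by simp
  with rec have "\<forall>\<^sub>F n in sequentially. \<bar>u (Suc n) - U\<bar> \<le> (1 + r) / 2 * \<bar>u n - U\<bar> + e n"
  proof eventually_elim
    case (elim n)
    have "u (Suc n) - U = ((\<beta> n - b) - (\<rho> n - r) * U) - \<rho> n * (u n - U)"
      unfolding elim(1) by (subst U) (simp add: algebra_simps)
    then have "\<bar>u (Suc n) - U\<bar> \<le> e n + \<bar>\<rho> n\<bar> * \<bar>u n - U\<bar>"
      unfolding e_def abs_mult[symmetric] by (simp only: abs_triangle_ineq4)
    also have "\<bar>\<rho> n\<bar> * \<bar>u n - U\<bar> \<le> (1 + r) / 2 * \<bar>u n - U\<bar>"
      using elim by (intro mult_right_mono) auto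
    finally show ?case by simp
  qed
  then have "(\<lambda>n. u n - U) \<longlonglongrightarrow> 0"
    using r by (intro contraction_tendsto_0[of "(1 + r) / 2" e, OF _ e0]) auto
  then show ?thesis using LIM_zero_iff unfolding U_def by blast
qed

text \<open>Up to the factor \<open>(-1)^n * cosh (pi * z)\<close>, this is $q(n) L - p(n)$ for \<open>y = z^2\<close>, where $L$ is
  the value of the continued fraction.\<close>

definition remainder :: "real \<Rightarrow> nat \<Rightarrow> real" where
  "remainder y n = shifted_prod (4 * y) n * shifted_prod (9 * y) n * series_sum y n / fact n"

lemma remainder_pos: "y \<ge> 0 \<Longrightarrow> remainder y n > 0"
  by (simp add: remainder_def shifted_prod_pos series_sum_pos)

text \<open>The products in \<open>remainder\<close> absorb the leading coefficient of
  \<open>series_sum_recurrence\<close> and leave b(m + 1) at the last term, while n! removes the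
  linear factors. The minus sign before a is the effect of dropping (-1)^n.\<close>

lemma remainder_recurrence:
  "remainder (z^2) (m + 2) = - cf7_a z (m + 2) * remainder (z^2) (m + 1) + cf7_b z (m + 1) * remainder (z^2) m"
proof -
  define y where "y = z^2"
  define n where "n = real m + 1"
  define M where "M = shifted_prod (4 * y) m * shifted_prod (9 * y) m / fact m"
  define B where "B = (n^2 + 4 * y) * (n^2 + 9 * y)"
  define B' where "B' = ((n + 1)^2 + 4 * y) * ((n + 1)^2 + 9 * y)"
  define a where "a = 11 * n^2 + 11 * n + 3 + 9 * y"
  have n: "n > 0" by (simp add: n_def)
  have r: "B' * series_sum y (m + 2) + (n + 1) * a * series_sum y (m + 1) - n * (n + 1) * series_sum y m = 0"
    using series_sum_recurrence[of y m] by (simp add: B'_def a_def n_def y_def)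
  have E0: "remainder y m = M * series_sum y m" by (simp add: remainder_def M_def)
  have E1: "remainder y (m + 1) = M * B * series_sum y (m + 1) / n"
    by (simp add: remainder_def M_def B_def n_def shifted_prod_Suc add.commute mult_ac)
  have E2: "remainder y (m + 2) = M * B * (B' * series_sum y (m + 2)) / (n * (n + 1))"
    by (simp add: remainder_def M_def B_def B'_def n_def shifted_prod_Suc numeral_2_eq_2 add_ac mult_ac)
  have a': "cf7_a z (m + 2) = a" by (simp add: cf7_a_def a_def y_def n_def power2_eq_square algebra_simps)
  have b': "cf7_b z (m + 1) = B" by (simp add: cf7_b_def B_def y_def n_def add.commute)
  have "B' * series_sum y (m + 2) = (n * series_sum y m - a * series_sum y (m + 1)) * (n + 1)" using r by (simp add: algebra_simps)
  then have "remainder y (m + 2) = M * B * (n * series_sum y m - a * series_sum y (m + 1)) / n"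
    unfolding E2 using n by simp
  also have "\<dots> = - a * remainder y (m + 1) + B * remainder y m"
    unfolding E0 E1 using n by (simp add: field_simps)
  finally show ?thesis unfolding a' b' y_def[symmetric] .
qed

lemma sprod_limits:
  assumes "z \<noteq> 0"
  shows "sprod (z^2) \<longlonglongrightarrow> sinh (pi * z) / (pi * z)"
    "sprod (4 * z^2) \<longlonglongrightarrow> sinh (2 * pi * z) / (2 * pi * z)"
    "sprod (9 * z^2) \<longlonglongrightarrow> sinh (3 * pi * z) / (3 * pi * z)"
  using sprod_limit[of z] sprod_limit[of "2 * z"] sprod_limit[of "3 * z"] assms
  by (simp_all add: power_mult_distrib mult_ac)

lemma sinh_ratio:
  assumes "z \<noteq> (0::real)"
  shows "(sinh (pi * z) / (pi * z)) / (sinh (2 * pi * z) / (2 * pi * z)) = 1 / cosh (pi * z)"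
proof -
  have "sinh (2 * pi * z) = 2 * sinh (pi * z) * cosh (pi * z)"
    using sinh_double[of "pi * z"] by (simp add: mult.assoc)
  moreover have "sinh (pi * z) \<noteq> 0" using assms by simp
  ultimately show ?thesis using assms by (simp add: field_simps)
qed

text \<open>These amount to the error formula at n = 0 and n = 1, where p(0) = 0, q(0) = 1, p(1) = 5
  and q(1) = 3 (1 - z^2).\<close>

lemma remainder_0:
  assumes "z \<noteq> 0"
  shows "cosh (pi * z) * remainder (z^2) 0 = (cosh (pi * z) - 1) / (3 * z^2)"
    and "remainder (z^2) 1 + 3 * (1 - z^2) * remainder (z^2) 0 = 5 / cosh (pi * z)"
proof -
  have "sinh (2 * pi * z) / (2 * pi * z) \<noteq> 0" using assms by simp
  then have lim: "(\<lambda>k. sprod (z^2) k / sprod (4 * z^2) k) \<longlonglongrightarrow> 1 / cosh (pi * z)"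
    unfolding sinh_ratio[OF assms, symmetric] by (intro tendsto_divide sprod_limits assms)
  have y: "z^2 > 0" using assms by simp
  show "cosh (pi * z) * remainder (z^2) 0 = (cosh (pi * z) - 1) / (3 * z^2)"
  proof -
    have "cosh (pi * z) * (1 - 1 / cosh (pi * z)) = cosh (pi * z) - 1"
      by (simp add: right_diff_distrib)
    then show ?thesis using series_sum_0[OF y lim] by (simp add: remainder_def)
  qed
  show "remainder (z^2) 1 + 3 * (1 - z^2) * remainder (z^2) 0 = 5 / cosh (pi * z)"
    using series_sum_1[OF y lim] by (simp add: remainder_def shifted_prod_def)
qed

lemma convergent_remainder:
  assumes "z \<noteq> 0"
  shows "cf_q (cf7_a z) (cf7_b z) n * ((cosh (pi * z) - 1) / (3 * z^2)) - cf_p (cf7_a z) (cf7_b z) n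
     = (-1) ^ n * cosh (pi * z) * remainder (z^2) n"
proof -
  define c where "c = cosh (pi * z)"
  define L where "L = (cosh (pi * z) - 1) / (3 * z^2)"
  have c: "c > 0" by (simp add: c_def)
  let ?R = "\<lambda>n. cf_q (cf7_a z) (cf7_b z) n * L - cf_p (cf7_a z) (cf7_b z) n = (-1) ^ n * c * remainder (z^2) n"
  have L: "L = c * remainder (z^2) 0" by (simp add: remainder_0(1)[OF assms] L_def c_def)
  have "c * (remainder (z^2) 1 + 3 * (1 - z^2) * remainder (z^2) 0) = 5"
    unfolding remainder_0(2)[OF assms] using c by (simp add: c_def)
  then have R1: "3 * (1 - z^2) * L - 5 = - (c * remainder (z^2) 1)"
    unfolding L by (simp add: algebra_simps)
  have "?R n \<and> ?R (Suc n)"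
  proof (induction n)
    case 0
    show ?case using L R1 by (simp add: cf7_a_def cf7_b_def)
  next
    case (Suc n)
    let ?a = "cf7_a z (n + 2)" and ?b = "cf7_b z (n + 1)"
    have "cf_q (cf7_a z) (cf7_b z) (Suc (Suc n)) * L - cf_p (cf7_a z) (cf7_b z) (Suc (Suc n))
      = ?a * (cf_q (cf7_a z) (cf7_b z) (Suc n) * L - cf_p (cf7_a z) (cf7_b z) (Suc n))
        + ?b * (cf_q (cf7_a z) (cf7_b z) n * L - cf_p (cf7_a z) (cf7_b z) n)"
      by (simp add: algebra_simps)
    also have "\<dots> = ?a * ((-1) ^ Suc n * c * remainder (z^2) (Suc n)) + ?b * ((-1) ^ n * c * remainder (z^2) n)"
      using Suc by simp
    also have "\<dots> = (-1) ^ n * c * (- ?a * remainder (z^2) (n + 1) + ?b * remainder (z^2) n)"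
      by (simp add: algebra_simps)
    also have "\<dots> = (-1) ^ Suc (Suc n) * c * remainder (z^2) (Suc (Suc n))"
      unfolding remainder_recurrence[symmetric] by simp
    finally show ?case using Suc by blast
  qed
  then show ?thesis unfolding L_def c_def by blast
qed

text \<open>With the alternating sign stripped from \<open>remainder\<close>, the Casoratian
  determinant becomes a sum. In one step the a-terms cancel and it is multiplied by b(n +
  1).\<close>

lemma casoratian:
  assumes "z \<noteq> 0"
  shows "cf_q (cf7_a z) (cf7_b z) n * remainder (z^2) (Suc n) + cf_q (cf7_a z) (cf7_b z) (Suc n) * remainder (z^2) n
     = 5 * shifted_prod (4 * z^2) n * shifted_prod (9 * z^2) n / cosh (pi * z)"
proof (induction n)
  case 0
  show ?case using remainder_0(2)[OF assms] by (simp add: cf7_a_def)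
next
  case (Suc n)
  let ?q = "cf_q (cf7_a z) (cf7_b z)" and ?r = "remainder (z^2)"
  have step: "?q (Suc n) * ?r (Suc (Suc n)) + ?q (Suc (Suc n)) * ?r (Suc n)
     = cf7_b z (n + 1) * (?q n * ?r (Suc n) + ?q (Suc n) * ?r n)"
  proof -
    have "?r (Suc (Suc n)) = - cf7_a z (n + 2) * ?r (Suc n) + cf7_b z (n + 1) * ?r n"
      using remainder_recurrence[of z n] by simp
    then show ?thesis by (simp only: cf_q.simps(3)) (simp add: algebra_simps)
  qed
  show ?case
    unfolding step Suc by (simp add: cf7_b_def shifted_prod_Suc add_ac mult_ac)
qed

section \<open>Golden ratio identities for the final constant\<close>

lemma golden_ratio_conv_inv_golden: "(1 + sqrt 5) / 2 = 1 / inv_golden"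
  using inv_golden_bounds by (simp add: inv_golden_def field_simps)

lemma sqrt5_inv_golden: "sqrt 5 * inv_golden = 1 + inv_golden^2"
proof -
  have "sqrt 5 = 2 * inv_golden + 1" by (simp add: inv_golden_def field_simps)
  then show ?thesis using inv_golden_sq by (simp add: algebra_simps power2_eq_square)
qed

text \<open>This is phi^5 + phi^(-5) = 5 sqrt 5 for the golden ratio phi, multiplied by phi^(-5). It
  evaluates the denominator 1 + r in the limit of the recurrence for q.\<close>

lemma inv_golden_pow_10: "1 + inv_golden ^ 10 = 5 * sqrt 5 * inv_golden^5"
proof -
  have s: "sqrt 5 = 2 * inv_golden + 1" by (simp add: inv_golden_def field_simps)
  have "inv_golden ^ 10 = (inv_golden^5)^2" by (simp flip: power_mult)
  then show ?thesis unfolding s inv_golden_powers using inv_golden_sq by algebra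
qed

theorem theorem7p3:
  fixes z :: real
  assumes "z \<noteq> 0"
  shows "((\<lambda>n. cf_p (cf7_a z) (cf7_b z) n / cf_q (cf7_a z) (cf7_b z) n)
           \<longlonglongrightarrow> (cosh (pi * z) - 1) / (3 * z^2)) \<and>
         ((\<lambda>n. (cosh (pi * z) - 1) / (3 * z^2)
               - cf_p (cf7_a z) (cf7_b z) n / cf_q (cf7_a z) (cf7_b z) n)
         \<sim>[sequentially]
         (\<lambda>n. (-1) ^ n * ((2 / (3 * z^2)) * sinh (2 * pi * z) * sinh (3 * pi * z))
               / ((1 + sqrt 5) / 2) ^ (10 * n + 5)))"
proof -
  define y where "y = z^2"
  define c where "c = cosh (pi * z)"
  define L where "L = (cosh (pi * z) - 1) / (3 * z^2)"
  define p where "p = cf_p (cf7_a z) (cf7_b z)"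
  define q where "q = cf_q (cf7_a z) (cf7_b z)"
  define s2 where "s2 = sinh (2 * pi * z) / (2 * pi * z)"
  define s3 where "s3 = sinh (3 * pi * z) / (3 * pi * z)"
  define K where "K = 2 * pi * inv_golden^3 / sqrt (1 + inv_golden^2)"
  \<comment> \<open>Normalised to have positive limits: with g for \<open>inv_golden\<close>, the
    remainder behaves like (n!)^2 g^(5n) / n and q like (n!)^2 g^(-5n) / n, up to constants.\<close>
  define \<epsilon> where "\<epsilon> n = real n * remainder y n / (fact n ^ 2 * inv_golden ^ (5 * n))" for n
  define u where "u n = real n * q n * inv_golden ^ (5 * n) / fact n ^ 2" for n
  \<comment> \<open>\<open>\<beta>\<close> and \<open>\<rho>\<close> are what appears when the
    Casoratian is solved for \<open>u (Suc n)\<close>.\<close>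
  define \<beta> where "\<beta> n = inv_golden^5 / \<epsilon> n * (real n / (real n + 1) * (5 * sprod (4 * y) n * sprod (9 * y) n / c))" for n
  define \<rho> where "\<rho> n = inv_golden ^ 10 * (\<epsilon> (Suc n) / \<epsilon> n)" for n
  have y: "y > 0" using assms by (simp add: y_def)
  have c: "c > 0" by (simp add: c_def)
  have inv_golden: "0 < inv_golden" "inv_golden < 1" using inv_golden_bounds by auto
  have al10: "inv_golden ^ 10 < 1" using inv_golden by (simp add: power_less_one_iff)
  have s: "sprod (4 * y) \<longlonglongrightarrow> s2" "sprod (9 * y) \<longlonglongrightarrow> s3"
    using sprod_limits[OF assms] by (simp_all add: y_def s2_def s3_def)
  have s_pos: "s2 > 0" "s3 > 0"
    using LIMSEQ_le_const[OF s(1), of 1] LIMSEQ_le_const[OF s(2), of 1] sprod_ge_1[of "4 * y"] sprod_ge_1[of "9 * y"] y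
    by (force intro: less_le_trans[OF zero_less_one])+
  have "sqrt (1 + inv_golden^2) > 0" by (simp add: add_pos_nonneg)
  then have K: "K > 0" using inv_golden by (simp add: K_def)
  \<comment> \<open>The final constant contains K only squared; \<open>sqrt5_inv_golden\<close> then
    trades the nested root for sqrt 5.\<close>
  have K2: "K^2 * sqrt 5 = 4 * pi^2 * inv_golden^5"
  proof -
    have "K^2 = 4 * pi^2 * inv_golden^6 / (1 + inv_golden^2)"
      by (simp add: K_def power_divide power_mult_distrib flip: power_mult)
    also have "\<dots> = 4 * pi^2 * inv_golden^5 / sqrt 5"
      unfolding sqrt5_inv_golden[symmetric] using inv_golden by (simp add: field_simps power_numeral_reduce)
    finally show ?thesis by simp
  qed
  have \<epsilon>_eq: "\<epsilon> n = sprod (4 * y) n * sprod (9 * y) n * (series_sum y n / series_sum 0 n) * (real n * fact n * series_sum 0 n / inv_golden ^ (5 * n))" for n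
    using series_sum_pos[of 0 n] by (simp add: \<epsilon>_def remainder_def shifted_prod_eq power2_eq_square)
  have "(\<lambda>n. series_sum y n / series_sum 0 n) \<longlonglongrightarrow> 1 / c"
    unfolding c_def sinh_ratio[OF assms, symmetric] using sprod_limits[OF assms] y
    by (intro series_sum_ratio_limit) (auto simp: y_def)
  then have \<epsilon>: "\<epsilon> \<longlonglongrightarrow> s2 * s3 * (1 / c) * K"
    unfolding \<epsilon>_eq K_def by (intro tendsto_mult s series_sum_0_asymptotics)
  have \<epsilon>_pos: "\<epsilon> n > 0" if "n > 0" for n
    using that inv_golden y remainder_pos[of y n] by (simp add: \<epsilon>_def)
  have lim0: "s2 * s3 * (1 / c) * K \<noteq> 0" using s_pos c K by simp
  have rec: "\<forall>\<^sub>F n in sequentially. u (Suc n) = \<beta> n - \<rho> n * u n"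
    using eventually_gt_at_top[of 0]
  proof eventually_elim
    case (elim n)
    define F where "F = (fact n :: real)"
    define a where "a = inv_golden ^ (5 * n)"
    have pos: "F > 0" "a > 0" "real n > 0" "\<epsilon> n > 0" using elim inv_golden \<epsilon>_pos by (auto simp: F_def a_def)
    have fS: "fact (Suc n) = (real n + 1) * F" "inv_golden ^ (5 * Suc n) = inv_golden^5 * a"
      by (simp_all add: F_def a_def add.commute flip: power_add)
    have r0: "remainder y n = \<epsilon> n * (F^2 * a) / real n"
      using pos inv_golden by (simp add: \<epsilon>_def F_def a_def)
    have r1: "remainder y (Suc n) = \<epsilon> (Suc n) * (real n + 1) * F^2 * (inv_golden^5 * a)"
      using pos inv_golden unfolding \<epsilon>_def fS by (simp add: power2_eq_square add.commute)
    have q0: "q n = u n * F^2 / (real n * a)"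
      using pos inv_golden by (simp add: u_def F_def a_def)
    have q1: "q (Suc n) = u (Suc n) * (real n + 1) * F^2 / (inv_golden^5 * a)"
      using pos inv_golden unfolding u_def fS by (simp add: power2_eq_square add.commute)
    have "q n * remainder y (Suc n) + q (Suc n) * remainder y n
       = 5 * (F^2 * sprod (4 * y) n) * (F^2 * sprod (9 * y) n) / c"
      using casoratian[OF assms, of n] by (simp add: q_def y_def c_def F_def shifted_prod_eq)
    moreover have "q n * remainder y (Suc n) = F^4 * ((real n + 1) / real n) * (u n * \<epsilon> (Suc n) * inv_golden^5)"
      unfolding q0 r1 using pos by (simp add: field_simps power_numeral_reduce)
    moreover have "q (Suc n) * remainder y n = F^4 * ((real n + 1) / real n) * (u (Suc n) * \<epsilon> n / inv_golden^5)"
      unfolding q1 r0 using pos inv_golden by (simp add: field_simps power_numeral_reduce)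
    moreover have "5 * (F^2 * sprod (4 * y) n) * (F^2 * sprod (9 * y) n) / c
       = F^4 * (5 * sprod (4 * y) n * sprod (9 * y) n / c)"
      by (simp add: power_numeral_reduce)
    ultimately have "F^4 * ((real n + 1) / real n * (u n * \<epsilon> (Suc n) * inv_golden^5 + u (Suc n) * \<epsilon> n / inv_golden^5))
       = F^4 * (5 * sprod (4 * y) n * sprod (9 * y) n / c)"
      by (simp only: distrib_left mult.assoc)
    then have eqB: "(real n + 1) / real n * (u n * \<epsilon> (Suc n) * inv_golden^5 + u (Suc n) * \<epsilon> n / inv_golden^5)
       = 5 * sprod (4 * y) n * sprod (9 * y) n / c" (is "_ = ?B")
      by (rule mult_left_cancel[THEN iffD1, rotated]) (use pos in simp)
    have eqR: "u n * \<epsilon> (Suc n) * inv_golden^5 + u (Suc n) * \<epsilon> n / inv_golden^5 = real n / (real n + 1) * ?B"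
    proof -
      have *: "X = N / (N + 1) * B" if "(N + 1) / N * X = B" "N > 0" for X N B :: real
        using that(2) unfolding that(1)[symmetric] by simp
      show ?thesis by (rule *[OF eqB pos(3)])
    qed
    have "u (Suc n) = inv_golden^5 / \<epsilon> n * (real n / (real n + 1) * ?B - u n * \<epsilon> (Suc n) * inv_golden^5)"
    proof -
      have *: "x = A / e * (R - w)" if "w + x * e / A = R" "e > 0" "A > 0" for x A e R w :: real
        using that(2,3) unfolding that(1)[symmetric] by simp
      show ?thesis by (rule *[OF eqR pos(4)]) (use inv_golden in simp)
    qed
    moreover have "inv_golden ^ 10 = inv_golden^5 * inv_golden^5" by (simp flip: power_add)
    moreover have "A / e * (R - v * w * A) = A / e * R - A * A * (w / e) * v" for A e R v w :: real
      by (simp add: right_diff_distrib)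
    ultimately show ?case unfolding \<beta>_def \<rho>_def by (simp only:)
  qed
  have "\<beta> \<longlonglongrightarrow> inv_golden^5 / (s2 * s3 * (1 / c) * K) * (1 * (5 * s2 * s3 / c))"
    unfolding \<beta>_def using c lim0
    by (intro tendsto_mult tendsto_divide tendsto_const s \<epsilon>) (simp_all, real_asymp)
  \<comment> \<open>The values \<open>s2\<close>, \<open>s3\<close> and \<open>c\<close> cancel, so
    the limit of \<open>u\<close> does not depend on z.\<close>
  also have "inv_golden^5 / (s2 * s3 * (1 / c) * K) * (1 * (5 * s2 * s3 / c)) = 5 * inv_golden^5 / K"
    using s_pos c K by simp
  finally have \<beta>: "\<beta> \<longlonglongrightarrow> 5 * inv_golden^5 / K" .
  have "\<rho> \<longlonglongrightarrow> inv_golden ^ 10 * ((s2 * s3 * (1 / c) * K) / (s2 * s3 * (1 / c) * K))"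
    unfolding \<rho>_def using lim0 by (intro tendsto_mult tendsto_divide tendsto_const LIMSEQ_Suc \<epsilon>)
  then have \<rho>: "\<rho> \<longlonglongrightarrow> inv_golden ^ 10" using lim0 by simp
  have "u \<longlonglongrightarrow> 5 * inv_golden^5 / K / (1 + inv_golden ^ 10)"
    by (rule linear_recurrence_limit[OF rec \<beta> \<rho> _ al10]) (use inv_golden in simp)
  also have "5 * inv_golden^5 / K / (1 + inv_golden ^ 10) = 1 / (sqrt 5 * K)"
    unfolding inv_golden_pow_10 using inv_golden K by simp
  finally have u: "u \<longlonglongrightarrow> 1 / (sqrt 5 * K)" .
  have u_lim_pos: "0 < 1 / (sqrt 5 * K)" using K by simp
  \<comment> \<open>Valid only eventually, since q(1) = 0 when z^2 = 1; the positive limit of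
    \<open>u\<close> keeps q(n) away from 0 for large n.\<close>
  have error: "\<forall>\<^sub>F n in sequentially. L - p n / q n = (-1) ^ n * (c * \<epsilon> n / u n) * inv_golden ^ (10 * n)"
    using order_tendstoD(1)[OF u u_lim_pos] eventually_gt_at_top[of 0]
  proof eventually_elim
    case (elim n)
    have "q n \<noteq> 0" using elim by (auto simp: u_def)
    moreover have "q n * L - p n = (-1) ^ n * c * remainder y n"
      unfolding p_def q_def L_def c_def y_def by (rule convergent_remainder[OF assms])
    ultimately have "L - p n / q n = (-1) ^ n * c * remainder y n / q n"
      by (simp add: field_simps)
    moreover have "inv_golden ^ (10 * n) = inv_golden ^ (5 * n) * inv_golden ^ (5 * n)" by (simp flip: power_add)
    ultimately show ?case
      using elim inv_golden \<open>q n \<noteq> 0\<close> by (simp add: \<epsilon>_def u_def)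
  qed
  define amp where "amp = (2 / (3 * z^2)) * sinh (2 * pi * z) * sinh (3 * pi * z)"
  have amp: "amp = 4 * pi^2 * s2 * s3"
    using assms by (simp add: amp_def s2_def s3_def power2_eq_square)
  have amp_pos: "amp > 0" using s_pos by (simp add: amp)
  have ratio: "(\<lambda>n. c * \<epsilon> n / u n) \<longlonglongrightarrow> c * (s2 * s3 * (1 / c) * K) / (1 / (sqrt 5 * K))"
    using K by (intro tendsto_divide tendsto_mult tendsto_const \<epsilon> u) auto
  also have "c * (s2 * s3 * (1 / c) * K) / (1 / (sqrt 5 * K)) = s2 * s3 * (K^2 * sqrt 5)"
    using c by (simp add: power2_eq_square)
  also have "\<dots> = amp * inv_golden^5"
    unfolding K2 amp by simp
  finally have ratio: "(\<lambda>n. c * \<epsilon> n / u n) \<longlonglongrightarrow> amp * inv_golden^5" .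
  have golden: "((1 + sqrt 5) / 2) ^ (10 * n + 5) = 1 / (inv_golden ^ (10 * n) * inv_golden^5)" for n
    unfolding golden_ratio_conv_inv_golden by (simp add: power_divide power_add)
  have "(\<lambda>n. (L - p n / q n) / ((-1) ^ n * amp / ((1 + sqrt 5) / 2) ^ (10 * n + 5))) \<longlonglongrightarrow> 1"
  proof (rule Lim_transform_eventually)
    show "(\<lambda>n. (c * \<epsilon> n / u n) / (amp * inv_golden^5)) \<longlonglongrightarrow> 1"
      using tendsto_divide[OF ratio tendsto_const[of "amp * inv_golden^5"]] amp_pos inv_golden by simp
    show "\<forall>\<^sub>F n in sequentially. (c * \<epsilon> n / u n) / (amp * inv_golden^5) =
        (L - p n / q n) / ((-1) ^ n * amp / ((1 + sqrt 5) / 2) ^ (10 * n + 5))"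
      using error by eventually_elim (use inv_golden in \<open>simp add: golden\<close>)
  qed
  then have asymp: "(\<lambda>n. L - p n / q n) \<sim>[sequentially] (\<lambda>n. (-1) ^ n * amp / ((1 + sqrt 5) / 2) ^ (10 * n + 5))"
    by (rule asymp_equivI')
  have "(\<lambda>n. L - p n / q n) \<longlonglongrightarrow> 0"
  proof (rule tendsto_rabs_zero_cancel, rule Lim_transform_eventually)
    have "(\<lambda>n. (inv_golden ^ 10) ^ n) \<longlonglongrightarrow> 0" using inv_golden al10 by (intro LIMSEQ_realpow_zero) auto
    from tendsto_mult[OF tendsto_rabs[OF ratio] this]
    show "(\<lambda>n. \<bar>c * \<epsilon> n / u n\<bar> * inv_golden ^ (10 * n)) \<longlonglongrightarrow> 0" by (simp add: power_mult)
    show "\<forall>\<^sub>F n in sequentially. \<bar>c * \<epsilon> n / u n\<bar> * inv_golden ^ (10 * n) = \<bar>L - p n / q n\<bar>"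
      using error by eventually_elim (use inv_golden in \<open>simp add: abs_mult power_abs\<close>)
  qed
  from tendsto_diff[OF tendsto_const[of L] this] have "(\<lambda>n. p n / q n) \<longlonglongrightarrow> L" by simp
  with asymp show ?thesis unfolding p_def q_def L_def amp_def by simp
qed

end
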